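(* Let $\mathbb{K}$ be $\mathbb{C}$ or $\mathbb{R}$, and let $\mathfrak{g}$ be a nilpotent non-abelian Lie algebra of vector fields on (some open subset of) $\mathbb{K}^2$. Then there exist an integer $N \geq 1$ and suitable local coordinates $(x,y)$ in which $$\mathfrak{g} \,=\, \langle \partial_y\rangle + \langle \partial_x,\, y\partial_x,\, \ldots,\, y^{N}\partial_x\rangle .$$
   Context: All vector fields are $C^\infty$, and a Lie algebra of vector fields on $\mathbb{K}^2$ means a Lie algebra (under the Lie bracket) of vector fields $P(x,y)\partial_x+Q(x,y)\partial_y$ defined on some open subset of $\mathbb{K}^2$. Here $\partial_x=\frac{\partial}{\partial x}$, $\partial_y=\frac{\partial}{\partial y}$, and $\langle\,\cdot\,\rangle$ denotes the $\mathbb{K}$-linear span. "In suitable coordinates" means up to a locally defined $C^\infty$ change of variables (point transformation), possibly after shrinking the open set. *)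

theory Defs
  imports "HOL-Analysis.Analysis" "HOL-Library.Function_Algebras" "HOL-Library.Set_Algebras"
begin

text \<open>
  The ground field is a type of class \<^class>\<open>real_normed_field\<close>; it is used at \<^typ>\<open>real\<close> and
  \<^typ>\<open>complex\<close>. All derivatives are taken over the ground field, so at \<^typ>\<open>complex\<close>
  infinitely differentiable means holomorphic.
\<close>

definition dx :: "('k::real_normed_field \<times> 'k \<Rightarrow> 'k) \<Rightarrow> 'k \<times> 'k \<Rightarrow> 'k" where
  "dx f p = deriv (\<lambda>t. f (t, snd p)) (fst p)"

definition dy :: "('k::real_normed_field \<times> 'k \<Rightarrow> 'k) \<Rightarrow> 'k \<times> 'k \<Rightarrow> 'k" where
  "dy f p = deriv (\<lambda>t. f (fst p, t)) (snd p)"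

fun Ck_on :: "nat \<Rightarrow> ('k::real_normed_field \<times> 'k) set \<Rightarrow> ('k \<times> 'k \<Rightarrow> 'k) \<Rightarrow> bool" where
  "Ck_on 0 U f \<longleftrightarrow> continuous_on U f"
| "Ck_on (Suc n) U f \<longleftrightarrow>
     (\<forall>p\<in>U. (f has_derivative (\<lambda>h. fst h * dx f p + snd h * dy f p)) (at p)) \<and>
     Ck_on n U (dx f) \<and> Ck_on n U (dy f)"

definition Cinf_on :: "('k::real_normed_field \<times> 'k) set \<Rightarrow> ('k \<times> 'k \<Rightarrow> 'k) \<Rightarrow> bool" where
  "Cinf_on U f \<longleftrightarrow> (\<forall>n. Ck_on n U f)"

definition Cinf_map_on :: "('k::real_normed_field \<times> 'k) set \<Rightarrow> ('k \<times> 'k \<Rightarrow> 'k \<times> 'k) \<Rightarrow> bool" where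
  "Cinf_map_on U F \<longleftrightarrow> Cinf_on U (\<lambda>p. fst (F p)) \<and> Cinf_on U (\<lambda>p. snd (F p))"

text \<open>
  The vector field \<open>P \<partial>\<^sub>x + Q \<partial>\<^sub>y\<close> on \<open>U\<close> is the map \<open>p \<mapsto> (P p, Q p)\<close>, extended by \<open>0\<close>
  outside \<open>U\<close> so that equality of vector fields on \<open>U\<close> is equality of functions.
\<close>

type_synonym 'k vfield = "'k \<times> 'k \<Rightarrow> 'k \<times> 'k"

definition vf_on ::
  "('k::real_normed_field \<times> 'k) set \<Rightarrow> ('k \<times> 'k \<Rightarrow> 'k) \<Rightarrow> ('k \<times> 'k \<Rightarrow> 'k) \<Rightarrow> 'k vfield" where
  "vf_on U P Q = (\<lambda>p. if p \<in> U then (P p, Q p) else 0)"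

definition vector_fields :: "('k::real_normed_field \<times> 'k) set \<Rightarrow> 'k vfield set" where
  "vector_fields U = {X. Cinf_map_on U X \<and> (\<forall>p. p \<notin> U \<longrightarrow> X p = 0)}"

definition vf_scale :: "'k::real_normed_field \<Rightarrow> 'k vfield \<Rightarrow> 'k vfield" where
  "vf_scale c X = (\<lambda>p. (c * fst (X p), c * snd (X p)))"

global_interpretation vf: vector_space "vf_scale :: 'k::real_normed_field \<Rightarrow> 'k vfield \<Rightarrow> 'k vfield"
  defines vf_subspace = vf.subspace and vf_span = vf.span
  by unfold_locales (auto simp: vf_scale_def fun_eq_iff algebra_simps)

definition vf_apply :: "'k::real_normed_field vfield \<Rightarrow> ('k \<times> 'k \<Rightarrow> 'k) \<Rightarrow> 'k \<times> 'k \<Rightarrow> 'k" where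
  "vf_apply X f p = fst (X p) * dx f p + snd (X p) * dy f p"

text \<open>
  For \<open>X\<close>, \<open>Y\<close> vanishing outside \<open>U\<close> the bracket vanishes there too, whatever the value of
  \<^const>\<open>deriv\<close> at points where it is not meaningful, since every term has a component of \<open>X p\<close> or
  \<open>Y p\<close> as a factor.
\<close>

definition lie_bracket :: "'k::real_normed_field vfield \<Rightarrow> 'k vfield \<Rightarrow> 'k vfield" where
  "lie_bracket X Y =
     (\<lambda>p. (vf_apply X (\<lambda>q. fst (Y q)) p - vf_apply Y (\<lambda>q. fst (X q)) p,
          vf_apply X (\<lambda>q. snd (Y q)) p - vf_apply Y (\<lambda>q. snd (X q)) p))"

definition vf_lie_algebra :: "('k::real_normed_field \<times> 'k) set \<Rightarrow> 'k vfield set \<Rightarrow> bool" where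
  "vf_lie_algebra U g \<longleftrightarrow>
     open U \<and> g \<subseteq> vector_fields U \<and> vf_subspace g \<and> (\<forall>X\<in>g. \<forall>Y\<in>g. lie_bracket X Y \<in> g)"

definition abelian :: "'k::real_normed_field vfield set \<Rightarrow> bool" where
  "abelian g \<longleftrightarrow> (\<forall>X\<in>g. \<forall>Y\<in>g. lie_bracket X Y = 0)"

fun lower_central :: "'k::real_normed_field vfield set \<Rightarrow> nat \<Rightarrow> 'k vfield set" where
  "lower_central g 0 = g"
| "lower_central g (Suc n) = vf_span {lie_bracket X Y | X Y. X \<in> g \<and> Y \<in> lower_central g n}"

definition nilpotent :: "'k::real_normed_field vfield set \<Rightarrow> bool" where
  "nilpotent g \<longleftrightarrow> (\<exists>n. lower_central g n = {0})"

definition coordinates ::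
  "('k::real_normed_field \<times> 'k) set \<Rightarrow> ('k \<times> 'k) set \<Rightarrow> ('k \<times> 'k \<Rightarrow> 'k \<times> 'k) \<Rightarrow> bool" where
  "coordinates V W \<phi> \<longleftrightarrow> open V \<and> open W \<and> bij_betw \<phi> V W \<and>
     Cinf_map_on V \<phi> \<and> Cinf_map_on W (inv_into V \<phi>)"

text \<open>
  The expression in the coordinates \<open>\<phi> = (\<phi>\<^sub>1, \<phi>\<^sub>2)\<close> of the restriction of \<open>X\<close> to \<open>V\<close>: the coefficients
  are \<open>X \<phi>\<^sub>1\<close> and \<open>X \<phi>\<^sub>2\<close>, written as functions of the new coordinates, which range over \<open>W\<close>.
\<close>

definition in_coordinates ::
  "('k::real_normed_field \<times> 'k) set \<Rightarrow> ('k \<times> 'k) set \<Rightarrow> ('k \<times> 'k \<Rightarrow> 'k \<times> 'k) \<Rightarrow> 'k vfield \<Rightarrow> 'k vfield"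
where
  "in_coordinates V W \<phi> X =
     vf_on W (\<lambda>q. vf_apply X (\<lambda>p. fst (\<phi> p)) (inv_into V \<phi> q))
             (\<lambda>q. vf_apply X (\<lambda>p. snd (\<phi> p)) (inv_into V \<phi> q))"

end

theory Submission
  imports Defs "HOL-Computational_Algebra.Polynomial"
begin

text \<open>
  Let \<open>Z\<close> be a nonzero element of the last nonvanishing term of the lower central series; it is
  central and a sum of brackets. If every field were parallel to \<open>Z\<close> wherever \<open>Z\<close> does not vanish,
  all brackets would vanish there, hence so would \<open>Z\<close>. So the fields parallel to \<open>Z\<close> do not exhaust
  \<open>g\<close>; pick \<open>X\<close> outside them in the last term of the lower central series that is not contained in
  them, and a point where \<open>Z\<close> and \<open>X\<close> are independent. As \<open>[Z, X] = 0\<close>, the coframe dual to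
  \<open>(Z, X)\<close> is closed, and integrating it gives coordinates \<open>(u, v)\<close> with \<open>Z = \<partial>\<^sub>u\<close>, \<open>X = \<partial>\<^sub>v\<close>; no flow
  is needed. Every \<open>Y\<close> in \<open>g\<close> is \<open>a Z + b X\<close> with \<open>Z a = Z b = 0\<close> because \<open>Z\<close> is central, \<open>X b = 0\<close>
  because \<open>[Y, X]\<close> is parallel to \<open>Z\<close>, and \<open>X\<^sup>n a = 0\<close> because \<open>g\<close> is nilpotent. Thus \<open>b\<close> is constant and
  \<open>a\<close> is a polynomial in \<open>v\<close>. The polynomials that occur form a nonzero space of bounded degree, closed
  under differentiation, and such a space consists of all polynomials up to some degree \<open>N\<close>.
\<close>

section \<open>Functions with partial derivatives of all orders\<close>

text \<open>The values \<open>a\<close> and \<open>b\<close> are parameters, so the rules below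
  compute partial derivatives alongside the total derivative; \<open>dx\<close> and
  \<open>dy\<close> are read off afterwards.\<close>

definition has_partials ::
  "('k::real_normed_field \<times> 'k \<Rightarrow> 'k) \<Rightarrow> 'k \<Rightarrow> 'k \<Rightarrow> 'k \<times> 'k \<Rightarrow> bool" where
  "has_partials f a b p \<longleftrightarrow> (f has_derivative (\<lambda>h. fst h * a + snd h * b)) (at p)"

text \<open>Restricting the total derivative to the horizontal and the vertical line through
  \<open>p\<close> leaves one-variable derivatives, and these are unique.\<close>

lemma has_partials_imp:
  assumes "has_partials f a b p"
  shows "dx f p = a" "dy f p = b"
proof -
  obtain x y where p: "p = (x, y)" by (cases p)
  have D: "(f has_derivative (\<lambda>h. fst h * a + snd h * b)) (at (x, y))"
    using assms by (simp add: has_partials_def p)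
  have "((\<lambda>t. f (t, y)) has_derivative (\<lambda>h. fst (h, 0::'a) * a + snd (h, 0::'a) * b)) (at x)"
    by (rule has_derivative_compose[of "\<lambda>t. (t, y)" "\<lambda>h. (h, 0)" x UNIV f, OF _ D])
      (auto intro!: derivative_eq_intros)
  then have "((\<lambda>t. f (t, y)) has_field_derivative a) (at x)"
    by (simp add: has_field_derivative_def mult.commute[of a] mult_commute_abs)
  then show "dx f p = a" by (simp add: dx_def p DERIV_imp_deriv)
  have "((\<lambda>t. f (x, t)) has_derivative (\<lambda>h. fst (0::'a, h) * a + snd (0::'a, h) * b)) (at y)"
    by (rule has_derivative_compose[of "\<lambda>t. (x, t)" "\<lambda>h. (0, h)" y UNIV f, OF _ D])
      (auto intro!: derivative_eq_intros)
  then have "((\<lambda>t. f (x, t)) has_field_derivative b) (at y)"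
    by (simp add: has_field_derivative_def mult_commute_abs)
  then show "dy f p = b" by (simp add: dy_def p DERIV_imp_deriv)
qed

lemma has_partials_cong:
  assumes "has_partials f a b p" "open U" "p \<in> U" "\<And>q. q \<in> U \<Longrightarrow> f q = f' q"
  shows "has_partials f' a b p"
  using assms has_derivative_transform_within_open[of f _ p UNIV U f']
  by (auto simp: has_partials_def)

lemma has_partials_continuous: "has_partials f a b p \<Longrightarrow> isCont f p"
  unfolding has_partials_def by (rule has_derivative_continuous)

lemma has_partials_const: "has_partials (\<lambda>_. c) 0 0 p"
  by (simp add: has_partials_def)

lemma has_partials_add:
  assumes "has_partials f a b p" "has_partials f' a' b' p"
  shows "has_partials (\<lambda>q. f q + f' q) (a + a') (b + b') p"
  using has_derivative_add[OF assms[unfolded has_partials_def]]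
  by (simp add: has_partials_def algebra_simps)

lemma has_partials_mult:
  assumes "has_partials f a b p" "has_partials f' a' b' p"
  shows "has_partials (\<lambda>q. f q * f' q) (a * f' p + f p * a') (b * f' p + f p * b') p"
  using has_derivative_mult[OF assms[unfolded has_partials_def]]
  by (simp add: has_partials_def algebra_simps)

lemma has_partials_inverse:
  assumes "has_partials f a b p" "f p \<noteq> 0"
  shows "has_partials (\<lambda>q. inverse (f q))
    (- (a * (inverse (f p) * inverse (f p)))) (- (b * (inverse (f p) * inverse (f p)))) p"
  using Deriv.has_derivative_inverse[OF assms(2) assms(1)[unfolded has_partials_def]]
  by (simp add: has_partials_def algebra_simps)

lemma has_partials_uminus: "has_partials f a b p \<Longrightarrow> has_partials (\<lambda>q. - f q) (- a) (- b) p"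
  using has_partials_mult[OF has_partials_const[of "-1"]] by fastforce

lemma has_partials_diff:
  "has_partials f a b p \<Longrightarrow> has_partials g c d p \<Longrightarrow> has_partials (\<lambda>q. f q - g q) (a - c) (b - d) p"
  using has_partials_add[OF _ has_partials_uminus] by fastforce

lemma has_partials_divide:
  assumes "has_partials f a b p" "has_partials g c d p" "g p \<noteq> 0"
  shows "has_partials (\<lambda>q. f q / g q)
    ((a * g p - f p * c) / (g p * g p)) ((b * g p - f p * d) / (g p * g p)) p"
proof -
  have "has_partials (\<lambda>q. f q * inverse (g q))
    (a * inverse (g p) + f p * - (c * (inverse (g p) * inverse (g p))))
    (b * inverse (g p) + f p * - (d * (inverse (g p) * inverse (g p)))) p"
    by (intro has_partials_mult has_partials_inverse assms)
  moreover have "a * inverse (g p) + f p * - (c * (inverse (g p) * inverse (g p))) =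
      (a * g p - f p * c) / (g p * g p)" for a c
    using assms(3) by (simp add: field_simps)
  ultimately show ?thesis by (simp only: divide_inverse)
qed

lemma has_partials_compose:
  assumes "has_partials g a b q" "has_partials h c d q" "has_partials f s t (g q, h q)"
  shows "has_partials (\<lambda>q. f (g q, h q)) (a * s + c * t) (b * s + d * t) q"
proof -
  have "((\<lambda>q. (g q, h q)) has_derivative
      (\<lambda>v. (fst v * a + snd v * b, fst v * c + snd v * d))) (at q)"
    using assms(1,2) unfolding has_partials_def by (rule has_derivative_Pair)
  from has_derivative_compose[OF this assms(3)[unfolded has_partials_def]] show ?thesis
    by (simp add: has_partials_def algebra_simps)
qed

lemma has_partials_poly:
  assumes "has_partials f a b q"
  shows "has_partials (\<lambda>q. poly p (f q)) (poly (pderiv p) (f q) * a) (poly (pderiv p) (f q) * b) q"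
proof -
  have "(poly p has_derivative (\<lambda>h. poly (pderiv p) (f q) * h)) (at (f q))"
    using poly_DERIV[of p "f q"] by (simp add: has_field_derivative_def)
  from has_derivative_compose[OF assms[unfolded has_partials_def] this]
  show ?thesis by (simp add: has_partials_def algebra_simps)
qed

section \<open>Closure properties of functions of class C^k\<close>

lemma Ck_on_Suc_partials:
  "Ck_on (Suc n) U f \<longleftrightarrow>
     (\<forall>p\<in>U. has_partials f (dx f p) (dy f p) p) \<and> Ck_on n U (dx f) \<and> Ck_on n U (dy f)"
  by (simp add: has_partials_def)

declare Ck_on.simps(2) [simp del]

text \<open>The slices of an open set through \<open>p\<close> are open, so the restrictions of
  \<open>f\<close> and \<open>g\<close> to both slices agree near \<open>p\<close>, and
  \<open>deriv\<close> depends only on the germ.\<close>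

lemma dx_cong: "(\<And>q. q \<in> U \<Longrightarrow> f q = g q) \<Longrightarrow> open U \<Longrightarrow> p \<in> U \<Longrightarrow> dx f p = dx g p"
  and dy_cong: "(\<And>q. q \<in> U \<Longrightarrow> f q = g q) \<Longrightarrow> open U \<Longrightarrow> p \<in> U \<Longrightarrow> dy f p = dy g p"
proof -
  assume *: "\<And>q. q \<in> U \<Longrightarrow> f q = g q" "open U" "p \<in> U"
  have "open ((\<lambda>t. (t, snd p)) -` U)" "open ((\<lambda>t. (fst p, t)) -` U)"
    by (auto intro!: open_vimage[OF *(2)] continuous_on_Pair continuous_on_id continuous_on_const)
  then have "\<forall>\<^sub>F t in nhds (fst p). t \<in> (\<lambda>t. (t, snd p)) -` U"
    "\<forall>\<^sub>F t in nhds (snd p). t \<in> (\<lambda>t. (fst p, t)) -` U"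
    using *(3) by (intro eventually_nhds_in_open; simp)+
  then have "\<forall>\<^sub>F t in nhds (fst p). f (t, snd p) = g (t, snd p)"
    "\<forall>\<^sub>F t in nhds (snd p). f (fst p, t) = g (fst p, t)"
    using *(1) by (simp_all add: eventually_mono)
  then show "dx f p = dx g p" "dy f p = dy g p"
    unfolding dx_def dy_def by (simp_all add: deriv_cong_ev)
qed

lemma Ck_on_cong:
  assumes "open U" "Ck_on n U f" "\<And>q. q \<in> U \<Longrightarrow> f q = g q"
  shows "Ck_on n U g"
  using assms(2,3)
proof (induction n arbitrary: f g)
  case 0
  then show ?case using continuous_on_cong[of U U f g] by simp
next
  case (Suc n)
  have d: "dx f p = dx g p" "dy f p = dy g p" if "p \<in> U" for p
    using dx_cong[OF Suc.prems(2) assms(1) that] dy_cong[OF Suc.prems(2) assms(1) that] by auto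
  have "has_partials g (dx g p) (dy g p) p" if "p \<in> U" for p
    using has_partials_cong[OF _ assms(1) that Suc.prems(2)] Suc.prems(1) d that
    by (auto simp: Ck_on_Suc_partials)
  moreover have "Ck_on n U (dx g)" "Ck_on n U (dy g)"
    using Suc.IH[of "dx f" "dx g"] Suc.IH[of "dy f" "dy g"] Suc.prems(1) d
    by (auto simp: Ck_on_Suc_partials)
  ultimately show ?case by (simp add: Ck_on_Suc_partials)
qed

text \<open>Any formulas \<open>a\<close>, \<open>b\<close> for the partials on \<open>U\<close> may
  replace \<open>dx f\<close> and \<open>dy f\<close>: being of class C^k on an open set depends
  only on the values there.\<close>

lemma Ck_on_SucI:
  assumes "open U" "\<And>p. p \<in> U \<Longrightarrow> has_partials f (a p) (b p) p" "Ck_on n U a" "Ck_on n U b"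
  shows "Ck_on (Suc n) U f"
proof -
  have d: "a p = dx f p" "b p = dy f p" if "p \<in> U" for p
    using has_partials_imp[OF assms(2)[OF that]] by auto
  show ?thesis
    using assms(2) d Ck_on_cong[OF assms(1) assms(3) d(1)] Ck_on_cong[OF assms(1) assms(4) d(2)]
    by (auto simp: Ck_on_Suc_partials)
qed

lemma Ck_on_Suc_imp: "Ck_on (Suc n) U f \<Longrightarrow> Ck_on n U f"
proof (induction n arbitrary: f)
  case 0
  then have "isCont f p" if "p \<in> U" for p
    using that has_partials_continuous unfolding Ck_on_Suc_partials by blast
  then show ?case by (simp add: continuous_at_imp_continuous_on)
next
  case (Suc n)
  then have "Ck_on n U (dx f)" "Ck_on n U (dy f)"
    using Ck_on_Suc_partials by blast+
  with Suc.prems show ?case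
    unfolding Ck_on_Suc_partials[of "Suc n"] Ck_on_Suc_partials[of n U f] by blast
qed

lemma Ck_on_const: "Ck_on n U (\<lambda>_. c)"
proof (induction n arbitrary: c)
  case (Suc n)
  have "dx (\<lambda>_. c) = (\<lambda>_. 0)" "dy (\<lambda>_. c) = (\<lambda>_. 0)"
    using has_partials_imp[OF has_partials_const] by blast+
  then show ?case using Suc has_partials_const[of c] by (auto simp: Ck_on_Suc_partials)
qed simp

lemma Ck_on_subset: "Ck_on n U f \<Longrightarrow> V \<subseteq> U \<Longrightarrow> Ck_on n V f"
proof (induction n arbitrary: f)
  case 0
  then show ?case using continuous_on_subset by simp
next
  case (Suc n)
  then show ?case unfolding Ck_on_Suc_partials by blast
qed

lemma Ck_on_add:
  assumes "open U" "Ck_on n U f" "Ck_on n U g"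
  shows "Ck_on n U (\<lambda>p. f p + g p)"
  using assms(2,3)
proof (induction n arbitrary: f g)
  case (Suc n)
  show ?case
  proof (rule Ck_on_SucI[OF assms(1)])
    show "has_partials (\<lambda>p. f p + g p) (dx f p + dx g p) (dy f p + dy g p) p" if "p \<in> U" for p
      using Suc.prems that by (simp add: Ck_on_Suc_partials has_partials_add)
    show "Ck_on n U (\<lambda>p. dx f p + dx g p)" "Ck_on n U (\<lambda>p. dy f p + dy g p)"
      using Suc.prems by (simp_all add: Ck_on_Suc_partials Suc.IH)
  qed
qed (simp add: continuous_on_add)

lemma Ck_on_mult:
  assumes "open U" "Ck_on n U f" "Ck_on n U g"
  shows "Ck_on n U (\<lambda>p. f p * g p)"
  using assms(2,3)
proof (induction n arbitrary: f g)
  case (Suc n)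
  \<comment> \<open>The product rule leaves \<open>f\<close> and \<open>g\<close> undifferentiated
    in some factors, so their own regularity of order \<open>n\<close> is required too.\<close>
  have fg: "Ck_on n U f" "Ck_on n U g"
    using Suc.prems by (auto dest: Ck_on_Suc_imp)
  show ?case
  proof (rule Ck_on_SucI[OF assms(1)])
    show "has_partials (\<lambda>p. f p * g p) (dx f p * g p + f p * dx g p) (dy f p * g p + f p * dy g p) p"
      if "p \<in> U" for p
      using Suc.prems that by (simp add: Ck_on_Suc_partials has_partials_mult)
    have "Ck_on n U (dx f)" "Ck_on n U (dy f)" "Ck_on n U (dx g)" "Ck_on n U (dy g)"
      using Suc.prems by (simp_all add: Ck_on_Suc_partials)
    with fg show "Ck_on n U (\<lambda>p. dx f p * g p + f p * dx g p)"
      "Ck_on n U (\<lambda>p. dy f p * g p + f p * dy g p)"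
      by (simp_all add: Ck_on_add[OF assms(1)] Suc.IH)
  qed
qed (simp add: continuous_on_mult)

lemma Ck_on_inverse:
  assumes "open U" "Ck_on n U f" "\<And>p. p \<in> U \<Longrightarrow> f p \<noteq> 0"
  shows "Ck_on n U (\<lambda>p. inverse (f p))"
  using assms(2,3)
proof (induction n arbitrary: f)
  case (Suc n)
  \<comment> \<open>The partials of 1/f, with the sign as a constant factor so that the rules for
    products and constants suffice.\<close>
  let ?g = "\<lambda>h p. (-1) * (h p * (inverse (f p) * inverse (f p)))"
  have inv: "Ck_on n U (\<lambda>p. inverse (f p))"
    using Suc.IH[OF Ck_on_Suc_imp[OF Suc.prems(1)] Suc.prems(2)] .
  show ?case
  proof (rule Ck_on_SucI[OF assms(1), of _ "?g (dx f)" "?g (dy f)"])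
    show "has_partials (\<lambda>p. inverse (f p)) (?g (dx f) p) (?g (dy f) p) p" if "p \<in> U" for p
      using has_partials_inverse[of f "dx f p" "dy f p" p] Suc.prems that
      by (auto simp: Ck_on_Suc_partials)
    have "Ck_on n U (dx f)" "Ck_on n U (dy f)"
      using Suc.prems by (simp_all add: Ck_on_Suc_partials)
    with inv show "Ck_on n U (?g (dx f))" "Ck_on n U (?g (dy f))"
      by (simp_all only: Ck_on_mult[OF assms(1)] Ck_on_const)
  qed
qed (simp add: continuous_on_inverse)

lemma Ck_on_compose:
  assumes "open W" "Ck_on n W g" "Ck_on n W h" "\<And>q. q \<in> W \<Longrightarrow> (g q, h q) \<in> V" "Ck_on n V f"
  shows "Ck_on n W (\<lambda>q. f (g q, h q))"
  using assms(2-)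
proof (induction n arbitrary: f)
  case 0
  then have "continuous_on W (\<lambda>q. (g q, h q))" "(\<lambda>q. (g q, h q)) ` W \<subseteq> V" "continuous_on V f"
    by (auto simp del: split_paired_All intro: continuous_on_Pair)
  then show ?case using continuous_on_compose2[of V f W] by simp
next
  case (Suc n)
  \<comment> \<open>The induction varies only the outer function: its hypothesis is applied to
    \<open>dx f\<close> and \<open>dy f\<close> with the same inner functions.\<close>
  have ff: "Ck_on n W (\<lambda>q. dx f (g q, h q))" "Ck_on n W (\<lambda>q. dy f (g q, h q))"
    using Suc.prems(4)
    by (auto simp: Ck_on_Suc_partials
      intro!: Suc.IH[OF Ck_on_Suc_imp[OF Suc.prems(1)] Ck_on_Suc_imp[OF Suc.prems(2)] Suc.prems(3)]
      simp del: split_paired_All)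
  show ?case
  proof (rule Ck_on_SucI[OF assms(1)])
    show "has_partials (\<lambda>q. f (g q, h q)) (dx g q * dx f (g q, h q) + dx h q * dy f (g q, h q))
        (dy g q * dx f (g q, h q) + dy h q * dy f (g q, h q)) q" if "q \<in> W" for q
      using has_partials_compose Suc.prems(1,2,4) Suc.prems(3)[OF that] that
      unfolding Ck_on_Suc_partials by blast
    have "Ck_on n W (dx g)" "Ck_on n W (dy g)" "Ck_on n W (dx h)" "Ck_on n W (dy h)"
      using Suc.prems by (simp_all add: Ck_on_Suc_partials)
    with ff show "Ck_on n W (\<lambda>q. dx g q * dx f (g q, h q) + dx h q * dy f (g q, h q))"
      "Ck_on n W (\<lambda>q. dy g q * dx f (g q, h q) + dy h q * dy f (g q, h q))"
      by (simp_all add: Ck_on_add[OF assms(1)] Ck_on_mult[OF assms(1)])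
  qed
qed

section \<open>Smooth functions\<close>

lemma Cinf_on_partials:
  assumes "Cinf_on U f" "p \<in> U"
  shows "has_partials f (dx f p) (dy f p) p"
  using assms Ck_on_Suc_partials unfolding Cinf_on_def by blast

lemma Cinf_on_dx: "Cinf_on U f \<Longrightarrow> Cinf_on U (dx f)"
  and Cinf_on_dy: "Cinf_on U f \<Longrightarrow> Cinf_on U (dy f)"
  using Ck_on_Suc_partials unfolding Cinf_on_def by blast+

lemma Cinf_on_continuous: "Cinf_on U f \<Longrightarrow> continuous_on U f"
  unfolding Cinf_on_def using Ck_on.simps(1) by blast

lemma Cinf_onI:
  assumes "open U" "\<And>p. p \<in> U \<Longrightarrow> has_partials f (a p) (b p) p" "Cinf_on U a" "Cinf_on U b"
  shows "Cinf_on U f"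
  unfolding Cinf_on_def
proof
  fix n
  have "Ck_on (Suc n) U f"
    using Ck_on_SucI[OF assms(1,2)] assms(3,4) unfolding Cinf_on_def by blast
  then show "Ck_on n U f" by (rule Ck_on_Suc_imp)
qed

lemma Cinf_on_const: "Cinf_on U (\<lambda>_. c)"
  by (simp add: Cinf_on_def Ck_on_const)

lemma Cinf_on_subset: "Cinf_on U f \<Longrightarrow> V \<subseteq> U \<Longrightarrow> Cinf_on V f"
  unfolding Cinf_on_def using Ck_on_subset by blast

lemma Cinf_on_cong: "open U \<Longrightarrow> Cinf_on U f \<Longrightarrow> (\<And>q. q \<in> U \<Longrightarrow> f q = g q) \<Longrightarrow> Cinf_on U g"
  unfolding Cinf_on_def using Ck_on_cong by blast

lemma Cinf_on_add: "open U \<Longrightarrow> Cinf_on U f \<Longrightarrow> Cinf_on U g \<Longrightarrow> Cinf_on U (\<lambda>p. f p + g p)"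
  unfolding Cinf_on_def using Ck_on_add by blast

lemma Cinf_on_mult: "open U \<Longrightarrow> Cinf_on U f \<Longrightarrow> Cinf_on U g \<Longrightarrow> Cinf_on U (\<lambda>p. f p * g p)"
  unfolding Cinf_on_def using Ck_on_mult by blast

lemma Cinf_on_uminus: "open U \<Longrightarrow> Cinf_on U f \<Longrightarrow> Cinf_on U (\<lambda>p. - f p)"
  using Cinf_on_mult[of U "\<lambda>_. -1" f] Cinf_on_const[of U "-1"] by simp

lemma Cinf_on_diff: "open U \<Longrightarrow> Cinf_on U f \<Longrightarrow> Cinf_on U g \<Longrightarrow> Cinf_on U (\<lambda>p. f p - g p)"
  using Cinf_on_add[of U f "\<lambda>p. - g p"] Cinf_on_uminus[of U g] by simp

lemma Cinf_on_divide:
  assumes "open U" "Cinf_on U f" "Cinf_on U g" "\<And>p. p \<in> U \<Longrightarrow> g p \<noteq> 0"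
  shows "Cinf_on U (\<lambda>p. f p / g p)"
proof -
  have "Cinf_on U (\<lambda>p. inverse (g p))"
    using assms Ck_on_inverse unfolding Cinf_on_def by blast
  then show ?thesis using Cinf_on_mult[OF assms(1,2)] by (simp add: divide_inverse)
qed

lemma Cinf_on_poly:
  assumes "open V" "Cinf_on V f"
  shows "Cinf_on V (\<lambda>q. poly p (f q))"
proof (induction p)
  case (pCons a p)
  then show ?case
    using assms by (simp add: Cinf_on_add Cinf_on_mult Cinf_on_const)
qed (simp add: Cinf_on_const)

section \<open>The Poincare lemma on a ball\<close>

text \<open>The differential with coefficients \<open>c\<close> as a bounded linear map, the form in
  which \<open>leibniz_rule\<close> takes derivatives.\<close>

definition lin_form :: "'k::real_normed_field \<times> 'k \<Rightarrow> ('k \<times> 'k) \<Rightarrow>\<^sub>L 'k" where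
  "lin_form c =
    (blinfun_mult_left (fst c) o\<^sub>L fst_blinfun) + (blinfun_mult_left (snd c) o\<^sub>L snd_blinfun)"

lemma lin_form_apply: "blinfun_apply (lin_form c) h = fst h * fst c + snd h * snd c"
  by (simp add: lin_form_def plus_blinfun.rep_eq)

lemma bounded_linear_lin_form: "bounded_linear lin_form"
  unfolding lin_form_def
  by (intro bounded_linear_add
      bounded_linear_compose[OF bounded_bilinear.bounded_linear_left[OF bounded_bilinear_blinfun_compose]]
      bounded_linear_compose[OF bounded_linear_blinfun_mult_left] bounded_linear_fst bounded_linear_snd)

lemma has_partials_lin_form:
  "has_partials f a b p \<longleftrightarrow> (f has_derivative blinfun_apply (lin_form (a, b))) (at p)"
  by (simp add: has_partials_def lin_form_apply[abs_def])

lemma has_partials_along_line: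
  assumes "has_partials f a b (p + t *\<^sub>R d)"
  shows "((\<lambda>t. f (p + t *\<^sub>R d)) has_vector_derivative (fst d * a + snd d * b)) (at t within S)"
proof -
  have "((\<lambda>t. p + t *\<^sub>R d) has_derivative (\<lambda>h. h *\<^sub>R d)) (at t within S)"
    by (auto intro!: derivative_eq_intros)
  from has_derivative_compose[OF this assms[unfolded has_partials_def]] show ?thesis
    by (simp add: has_vector_derivative_def scaleR_right_distrib)
qed

text \<open>The primitive at \<open>q\<close> is the integral of \<open>A dx + B dy\<close> along
  the segment from \<open>p\<close> to \<open>q\<close>, differentiated under the integral sign. The
  parameter of the segment is real over either ground field, while the resulting differential
  \<open>lin_form (A q, B q)\<close> is linear over \<open>'k\<close>; this treats the real and the
  holomorphic case at once.\<close>

lemma Poincare_ball: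
  fixes A B :: "'k::{real_normed_field,euclidean_space} \<times> 'k \<Rightarrow> 'k"
  assumes A: "Cinf_on (ball p r) A" and B: "Cinf_on (ball p r) B"
    and closed: "\<And>q. q \<in> ball p r \<Longrightarrow> dy A q = dx B q"
  obtains u where "\<And>q. q \<in> ball p r \<Longrightarrow> has_partials u (A q) (B q) q"
proof -
  let ?V = "ball p r"
  define \<gamma> where "\<gamma> q t = p + t *\<^sub>R (q - p)" for q :: "'k \<times> 'k" and t :: real
  have \<gamma>: "\<gamma> q t \<in> ?V" if "q \<in> ?V" "t \<in> {0..1}" for q t
  proof -
    have "\<gamma> q t = (1 - t) *\<^sub>R p + t *\<^sub>R q"
      by (simp add: \<gamma>_def algebra_simps)
    moreover have "p \<in> ?V"
      using that(1) by (metis ball_eq_empty centre_in_ball empty_iff not_le)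
    ultimately show ?thesis
      using convexD[OF convex_ball, of p p r q "1 - t" t] that by simp
  qed
  \<comment> \<open>This is the derivative of \<open>f (\<gamma> q t)\<close> in \<open>t\<close>.
    \<open>F\<close> is the pullback of the form to the segment, and \<open>F'\<close> its
    differential in \<open>q\<close>, written with \<open>dx B\<close> and \<open>dy A\<close>
    already exchanged by closedness.\<close>
  define line_derivative where "line_derivative f q t =
    fst (q - p) * dx f (\<gamma> q t) + snd (q - p) * dy f (\<gamma> q t)" for f q t
  define F where "F q t = fst (q - p) * A (\<gamma> q t) + snd (q - p) * B (\<gamma> q t)" for q t
  define F' where "F' q t = lin_form (A (\<gamma> q t) + t *\<^sub>R line_derivative A q t,
    B (\<gamma> q t) + t *\<^sub>R line_derivative B q t)" for q t
  have cont: "continuous_on (?V \<times> {0..1}) (\<lambda>(q, t). f (\<gamma> q t))" if "Cinf_on ?V f" for f :: "'k \<times> 'k \<Rightarrow> 'k"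
  proof -
    have "continuous_on (?V \<times> {0..1}) (\<lambda>z. f (p + snd z *\<^sub>R (fst z - p)))"
      by (rule continuous_on_compose2[OF Cinf_on_continuous[OF that]])
        (use \<gamma> in \<open>auto simp: \<gamma>_def intro!: continuous_intros\<close>)
    then show ?thesis by (simp add: \<gamma>_def case_prod_beta)
  qed
  have contd: "continuous_on (?V \<times> {0..1}) (\<lambda>(q, t). f (\<gamma> q t) + t *\<^sub>R line_derivative f q t)"
    if "Cinf_on ?V f" for f
    using cont[OF that] cont[OF Cinf_on_dx[OF that]] cont[OF Cinf_on_dy[OF that]]
    by (auto simp: line_derivative_def case_prod_beta intro!: continuous_intros)
  have contF': "continuous_on (?V \<times> cbox 0 1) (\<lambda>(q, t). F' q t)"
    using contd[OF A] contd[OF B]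
    by (auto simp: F'_def case_prod_beta
        intro!: bounded_linear.continuous_on[OF bounded_linear_lin_form] continuous_intros)
  have deriv_F: "((\<lambda>q. F q t) has_derivative blinfun_apply (F' q t)) (at q within ?V)"
    if "q \<in> ?V" "t \<in> cbox 0 1" for q t
  proof -
    have t: "\<gamma> q t \<in> ?V" using \<gamma> that by simp
    have \<gamma>': "((\<lambda>q. \<gamma> q t) has_derivative (\<lambda>h. t *\<^sub>R h)) (at q within ?V)"
      unfolding \<gamma>_def by (auto intro!: derivative_eq_intros)
    have 1: "((\<lambda>q. A (\<gamma> q t)) has_derivative
        (\<lambda>h. fst (t *\<^sub>R h) * dx A (\<gamma> q t) + snd (t *\<^sub>R h) * dy A (\<gamma> q t))) (at q within ?V)"
      by (rule has_derivative_compose[OF \<gamma>' Cinf_on_partials[OF A t, unfolded has_partials_def]])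
    have 2: "((\<lambda>q. B (\<gamma> q t)) has_derivative
        (\<lambda>h. fst (t *\<^sub>R h) * dx B (\<gamma> q t) + snd (t *\<^sub>R h) * dy B (\<gamma> q t))) (at q within ?V)"
      by (rule has_derivative_compose[OF \<gamma>' Cinf_on_partials[OF B t, unfolded has_partials_def]])
    have 3: "((\<lambda>q. fst (q - p)) has_derivative fst) (at q within ?V)"
      "((\<lambda>q. snd (q - p)) has_derivative snd) (at q within ?V)"
      by (auto intro!: derivative_eq_intros)
    show ?thesis
      unfolding F_def
      by (rule has_derivative_eq_rhs, rule has_derivative_add, rule has_derivative_mult[OF 3(1) 1],
          rule has_derivative_mult[OF 3(2) 2])
        (simp add: F'_def lin_form_apply line_derivative_def closed[OF t, symmetric]
          fun_eq_iff algebra_simps)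
  qed
  have int_F': "integral (cbox 0 1) (F' q) = lin_form (A q, B q)" if "q \<in> ?V" for q
  proof -
    \<comment> \<open>By the product rule the coefficients of \<open>F'\<close> are exact
      derivatives in \<open>t\<close>, so its integral is a difference of boundary values.\<close>
    have vd: "((\<lambda>t. t *\<^sub>R f (\<gamma> q t)) has_vector_derivative
        f (\<gamma> q t) + t *\<^sub>R line_derivative f q t) (at t within {0..1})"
      if "Cinf_on ?V f" "t \<in> {0..1}" for f t
    proof -
      have "((\<lambda>t. f (\<gamma> q t)) has_vector_derivative line_derivative f q t) (at t within {0..1})"
        unfolding \<gamma>_def line_derivative_def
        by (rule has_partials_along_line)
          (use Cinf_on_partials[OF that(1) \<gamma>[OF \<open>q \<in> ?V\<close> that(2)]] in \<open>simp add: \<gamma>_def\<close>)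
      from has_vector_derivative_scaleR[OF DERIV_ident this] show ?thesis
        by (simp add: add.commute)
    qed
    have "((\<lambda>t. lin_form (t *\<^sub>R A (\<gamma> q t), t *\<^sub>R B (\<gamma> q t))) has_vector_derivative F' q t)
        (at t within {0..1})" if "t \<in> {0..1}" for t
      unfolding F'_def
      by (rule bounded_linear.has_vector_derivative[OF bounded_linear_lin_form]
          has_vector_derivative_Pair vd A B that)+
    \<comment> \<open>The factor \<open>t\<close> removes the boundary term at 0; at 1 the segment
      has reached \<open>q\<close>.\<close>
    then have "(F' q has_integral (lin_form (1 *\<^sub>R A (\<gamma> q 1), 1 *\<^sub>R B (\<gamma> q 1))
        - lin_form (0 *\<^sub>R A (\<gamma> q 0), 0 *\<^sub>R B (\<gamma> q 0)))) {0..1}"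
      by (intro fundamental_theorem_of_calculus) auto
    moreover have "lin_form (0 :: 'k, 0) = 0"
      by (rule blinfun_eqI) (simp add: lin_form_apply)
    moreover have "\<gamma> q 1 = q" by (simp add: \<gamma>_def)
    ultimately have "(F' q has_integral lin_form (A q, B q)) {0..1}" by simp
    then show ?thesis by (simp add: integral_unique)
  qed
  have "F q integrable_on cbox 0 1" if "q \<in> ?V" for q
  proof (rule integrable_continuous)
    have "continuous_on (?V \<times> {0..1}) (\<lambda>(q, t). F q t)"
      using cont[OF A] cont[OF B] by (auto simp: F_def case_prod_beta intro!: continuous_intros)
    then have "continuous_on {0..1} (\<lambda>t. (\<lambda>(q, t). F q t) (q, t))"
      by (rule continuous_on_compose2) (use that in \<open>auto intro!: continuous_intros\<close>)
    then show "continuous_on (cbox 0 1) (F q)" by simp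
  qed
  then have du: "((\<lambda>q. integral (cbox 0 1) (F q)) has_derivative blinfun_apply (lin_form (A q, B q)))
      (at q within ?V)" if "q \<in> ?V" for q
    using leibniz_rule[where U = ?V and f = F and fx = F' and ?x0.0 = q and a = 0 and b = 1]
      deriv_F contF' convex_ball that unfolding int_F'[OF that, symmetric] by blast
  have "has_partials (\<lambda>q. integral (cbox 0 1) (F q)) (A q) (B q) q" if "q \<in> ?V" for q
    using du[OF that] unfolding has_partials_lin_form at_within_open[OF that open_ball] .
  then show thesis by (rule that)
qed

section \<open>Coordinates adapted to a commuting frame\<close>

text \<open>The matrix with rows \<open>c\<close> and \<open>d\<close>, as a bounded linear map for
  use in the inverse function theorem.\<close>

definition lin_map :: "'k::real_normed_field \<times> 'k \<Rightarrow> 'k \<times> 'k \<Rightarrow> ('k \<times> 'k) \<Rightarrow>\<^sub>L ('k \<times> 'k)" where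
  "lin_map c d = (Blinfun (\<lambda>x. (x, 0)) o\<^sub>L lin_form c) + (Blinfun (\<lambda>x. (0, x)) o\<^sub>L lin_form d)"

lemma lin_map_apply:
  "blinfun_apply (lin_map c d) h = (fst h * fst c + snd h * snd c, fst h * fst d + snd h * snd d)"
proof -
  have "bounded_linear (\<lambda>x::'a. (x, 0::'a))" "bounded_linear (\<lambda>x::'a. (0::'a, x))"
    by (intro bounded_linear_Pair bounded_linear_ident bounded_linear_zero)+
  then show ?thesis
    by (simp add: lin_map_def plus_blinfun.rep_eq bounded_linear_Blinfun_apply lin_form_apply)
qed

lemma continuous_on_lin_map:
  assumes "continuous_on S a" "continuous_on S b" "continuous_on S c" "continuous_on S d"
  shows "continuous_on S (\<lambda>p. lin_map (a p, b p) (c p, d p))"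
proof -
  have l: "continuous_on S (\<lambda>p. lin_form (f p, g p))" if "continuous_on S f" "continuous_on S g"
    for f g :: "'a \<Rightarrow> 'b"
    by (rule bounded_linear.continuous_on[OF bounded_linear_lin_form continuous_on_Pair[OF that]])
  show ?thesis
    unfolding lin_map_def
    by (intro continuous_on_add l assms continuous_on_const
        bounded_bilinear.continuous_on[OF bounded_bilinear_blinfun_compose])
qed

lemma has_partials_Pair:
  "(\<phi> has_derivative blinfun_apply (lin_map (a, b) (c, d))) (at p) \<longleftrightarrow>
    has_partials (\<lambda>q. fst (\<phi> q)) a b p \<and> has_partials (\<lambda>q. snd (\<phi> q)) c d p"
proof
  assume *: "(\<phi> has_derivative blinfun_apply (lin_map (a, b) (c, d))) (at p)"
  show "has_partials (\<lambda>q. fst (\<phi> q)) a b p \<and> has_partials (\<lambda>q. snd (\<phi> q)) c d p"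
    using has_derivative_fst[OF *] has_derivative_snd[OF *]
    by (simp add: has_partials_def lin_map_apply)
next
  assume "has_partials (\<lambda>q. fst (\<phi> q)) a b p \<and> has_partials (\<lambda>q. snd (\<phi> q)) c d p"
  then have "((\<lambda>q. fst (\<phi> q)) has_derivative (\<lambda>h. fst h * a + snd h * b)) (at p)"
    "((\<lambda>q. snd (\<phi> q)) has_derivative (\<lambda>h. fst h * c + snd h * d)) (at p)"
    by (simp_all add: has_partials_def)
  from has_derivative_Pair[OF this] have "((\<lambda>q. (fst (\<phi> q), snd (\<phi> q))) has_derivative
      (\<lambda>h. (fst h * a + snd h * b, fst h * c + snd h * d))) (at p)"
    .
  then show "(\<phi> has_derivative blinfun_apply (lin_map (a, b) (c, d))) (at p)"
    by (simp add: lin_map_apply[abs_def])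
qed

text \<open>Bootstrapping: \<open>g\<close> satisfies a first-order system whose right-hand side is
  a smooth function of \<open>g\<close>, so if \<open>g\<close> is of class C^n then so are its
  partials, and \<open>g\<close> is of class C^(n+1). It will be applied to the inverse of a
  chart.\<close>

lemma Ck_on_inverse_function:
  assumes "open W" "\<And>y. y \<in> W \<Longrightarrow> g y \<in> V"
    and "\<And>n. Ck_on n V P1" "\<And>n. Ck_on n V P2" "\<And>n. Ck_on n V Q1" "\<And>n. Ck_on n V Q2"
    and "\<And>y. y \<in> W \<Longrightarrow> has_partials (\<lambda>y. fst (g y)) (P1 (g y)) (Q1 (g y)) y"
    and "\<And>y. y \<in> W \<Longrightarrow> has_partials (\<lambda>y. snd (g y)) (P2 (g y)) (Q2 (g y)) y"
  shows "Ck_on n W (\<lambda>y. fst (g y)) \<and> Ck_on n W (\<lambda>y. snd (g y))"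
proof (induction n)
  case 0
  show ?case
    using assms(7,8) has_partials_continuous
    by (auto intro!: continuous_at_imp_continuous_on simp del: split_paired_All) blast+
next
  case (Suc n)
  have "Ck_on n W (\<lambda>y. f (g y))" if "Ck_on n V f" for f
    using Ck_on_compose[OF assms(1), of n "\<lambda>y. fst (g y)" "\<lambda>y. snd (g y)" V f] Suc that assms(2)
    by simp
  then show ?case
    using Ck_on_SucI[OF assms(1) assms(7)] Ck_on_SucI[OF assms(1) assms(8)] assms(3-6) by blast
qed

text \<open>The determinant with columns \<open>v\<close> and \<open>w\<close>: it tests
  independence and gives components by Cramer's rule.\<close>

definition symplectic :: "'k::comm_ring_1 \<times> 'k \<Rightarrow> 'k \<times> 'k \<Rightarrow> 'k" where
  "symplectic v w = fst v * snd w - snd v * fst w"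

text \<open>The differentials of the two components of \<open>\<phi>\<close> form the coframe dual to \<open>(Z, X)\<close>.\<close>

definition coordinate_frame ::
  "('k::real_normed_field \<times> 'k) set \<Rightarrow> ('k \<times> 'k \<Rightarrow> 'k \<times> 'k) \<Rightarrow> 'k vfield \<Rightarrow> 'k vfield \<Rightarrow> bool" where
  "coordinate_frame V \<phi> Z X \<longleftrightarrow> (\<forall>q\<in>V. symplectic (Z q) (X q) \<noteq> 0 \<and>
    has_partials (\<lambda>q. fst (\<phi> q)) (snd (X q) / symplectic (Z q) (X q))
      (- fst (X q) / symplectic (Z q) (X q)) q \<and>
    has_partials (\<lambda>q. snd (\<phi> q)) (- snd (Z q) / symplectic (Z q) (X q))
      (fst (Z q) / symplectic (Z q) (X q)) q)"

lemma lie_bracket_eq_0_iff: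
  "lie_bracket X Y p = 0 \<longleftrightarrow>
    vf_apply X (\<lambda>q. fst (Y q)) p = vf_apply Y (\<lambda>q. fst (X q)) p \<and>
    vf_apply X (\<lambda>q. snd (Y q)) p = vf_apply Y (\<lambda>q. snd (X q)) p"
  by (simp add: lie_bracket_def zero_prod_def)

text \<open>For a form \<open>\<theta>\<close> of the dual coframe, \<open>\<theta>(Z)\<close> and
  \<open>\<theta>(X)\<close> are constant, so d\<open>\<theta>\<close>(Z, X) =
  -\<open>\<theta>\<close>([Z, X]) = 0. The proof verifies this in coordinates.\<close>

lemma dual_coframe_closed:
  fixes Z X :: "'k::real_normed_field vfield"
  assumes Z: "has_partials (\<lambda>q. fst (Z q)) z1x z1y p" "has_partials (\<lambda>q. snd (Z q)) z2x z2y p"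
    and X: "has_partials (\<lambda>q. fst (X q)) x1x x1y p" "has_partials (\<lambda>q. snd (X q)) x2x x2y p"
    and nz: "symplectic (Z p) (X p) \<noteq> 0" and br: "lie_bracket Z X p = 0"
  shows "dy (\<lambda>q. snd (X q) / symplectic (Z q) (X q)) p = dx (\<lambda>q. - fst (X q) / symplectic (Z q) (X q)) p"
    and "dy (\<lambda>q. - snd (Z q) / symplectic (Z q) (X q)) p = dx (\<lambda>q. fst (Z q) / symplectic (Z q) (X q)) p"
proof -
  define D where "D = symplectic (Z p) (X p)"
  have D: "has_partials (\<lambda>q. symplectic (Z q) (X q))
    ((z1x * snd (X p) + fst (Z p) * x2x) - (z2x * fst (X p) + snd (Z p) * x1x))
    ((z1y * snd (X p) + fst (Z p) * x2y) - (z2y * fst (X p) + snd (Z p) * x1y)) p"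
    unfolding symplectic_def by (intro has_partials_diff has_partials_mult Z X)
  have br': "fst (Z p) * x1x + snd (Z p) * x1y = fst (X p) * z1x + snd (X p) * z1y"
    "fst (Z p) * x2x + snd (Z p) * x2y = fst (X p) * z2x + snd (X p) * z2y"
    using br by (simp_all add: lie_bracket_eq_0_iff vf_apply_def has_partials_imp[OF Z(1)]
        has_partials_imp[OF Z(2)] has_partials_imp[OF X(1)] has_partials_imp[OF X(2)])
  \<comment> \<open>Both quotients have the square of the determinant as denominator; once it is
    cancelled, the numerators agree by the two bracket equations \<open>br'\<close>.\<close>
  show "dy (\<lambda>q. snd (X q) / symplectic (Z q) (X q)) p = dx (\<lambda>q. - fst (X q) / symplectic (Z q) (X q)) p"
    using nz br'
    unfolding has_partials_imp[OF has_partials_divide[OF X(2) D nz]]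
      has_partials_imp[OF has_partials_divide[OF has_partials_uminus[OF X(1)] D nz]]
    by (simp add: divide_cancel_right symplectic_def) algebra
  show "dy (\<lambda>q. - snd (Z q) / symplectic (Z q) (X q)) p = dx (\<lambda>q. fst (Z q) / symplectic (Z q) (X q)) p"
    using nz br'
    unfolding has_partials_imp[OF has_partials_divide[OF Z(1) D nz]]
      has_partials_imp[OF has_partials_divide[OF has_partials_uminus[OF Z(2)] D nz]]
    by (simp add: divide_cancel_right symplectic_def) algebra
qed

text \<open>Primitives \<open>u\<close>, \<open>v\<close> of the dual coframe form a map whose
  Jacobian is inverse to the matrix with columns \<open>Z\<close> and \<open>X\<close>. The inverse
  function theorem makes it a chart, and its inverse has \<open>Z\<close> and \<open>X\<close> as
  partial derivatives.\<close>

lemma coordinates_of_commuting_frame: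
  fixes Z X :: "'k::{real_normed_field,euclidean_space} vfield"
  assumes "open U" "p \<in> U" and Z: "Cinf_map_on U Z" and X: "Cinf_map_on U X"
    and br: "\<And>q. q \<in> U \<Longrightarrow> lie_bracket Z X q = 0" and nz: "symplectic (Z p) (X p) \<noteq> 0"
  obtains V W \<phi> where "p \<in> V" "V \<subseteq> U" "convex V" "coordinates V W \<phi>" "coordinate_frame V \<phi> Z X"
proof -
  define D where "D q = symplectic (Z q) (X q)" for q
  have comp: "Cinf_on U (\<lambda>q. fst (Z q))" "Cinf_on U (\<lambda>q. snd (Z q))"
    "Cinf_on U (\<lambda>q. fst (X q))" "Cinf_on U (\<lambda>q. snd (X q))"
    using Z X by (simp_all add: Cinf_map_on_def)
  have D: "Cinf_on U D"
    unfolding D_def symplectic_def by (intro Cinf_on_diff Cinf_on_mult \<open>open U\<close> comp)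
  have "open (U \<inter> D -` (- {0}))"
    by (rule continuous_open_preimage[OF Cinf_on_continuous[OF D] \<open>open U\<close>])
      (intro open_Compl closed_singleton)
  moreover have "p \<in> U \<inter> D -` (- {0})"
    using \<open>p \<in> U\<close> nz by (simp add: D_def)
  ultimately obtain r where r: "r > 0" "ball p r \<subseteq> U \<inter> D -` (- {0})"
    unfolding open_contains_ball by blast
  then have sub: "ball p r \<subseteq> U" and D0: "\<And>q. q \<in> ball p r \<Longrightarrow> D q \<noteq> 0"
    by auto
  define A where "A q = snd (X q) / D q" for q
  define B where "B q = - fst (X q) / D q" for q
  define C where "C q = - snd (Z q) / D q" for q
  define E where "E q = fst (Z q) / D q" for q
  note defs = A_def[abs_def] B_def[abs_def] C_def[abs_def] E_def[abs_def]
  have smooth: "Cinf_on (ball p r) A" "Cinf_on (ball p r) B" "Cinf_on (ball p r) C" "Cinf_on (ball p r) E"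
    unfolding defs
    by (intro Cinf_on_divide Cinf_on_uminus comp[THEN Cinf_on_subset[OF _ sub]] open_ball D0
        Cinf_on_subset[OF D sub]; assumption)+
  have closed: "dy A q = dx B q" "dy C q = dx E q" if "q \<in> ball p r" for q
  proof -
    have "q \<in> U" using that sub by blast
    from dual_coframe_closed[OF comp[THEN Cinf_on_partials[OF _ this]]] br[OF this] D0[OF that]
    show "dy A q = dx B q" "dy C q = dx E q"
      unfolding defs D_def by blast+
  qed
  obtain u where u: "\<And>q. q \<in> ball p r \<Longrightarrow> has_partials u (A q) (B q) q"
    using Poincare_ball[OF smooth(1,2) closed(1)] by blast
  obtain v where v: "\<And>q. q \<in> ball p r \<Longrightarrow> has_partials v (C q) (E q) q"
    using Poincare_ball[OF smooth(3,4) closed(2)] by blast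
  define \<phi> where "\<phi> q = (u q, v q)" for q
  define f' where "f' q = lin_map (A q, B q) (C q, E q)" for q
  have f': "(\<phi> has_derivative blinfun_apply (f' q)) (at q)" if "q \<in> ball p r" for q
    unfolding f'_def has_partials_Pair using u[OF that] v[OF that] by (simp add: \<phi>_def)
  \<comment> \<open>The matrix with columns \<open>Z q\<close> and \<open>X q\<close>, an explicit
    two-sided inverse of \<open>f' q\<close>.\<close>
  define h where "h q = lin_map (fst (Z q), fst (X q)) (snd (Z q), snd (X q))" for q
  have inv1: "blinfun_apply (h q) (blinfun_apply (f' q) w) = w"
    and inv2: "blinfun_apply (f' q) (blinfun_apply (h q) w) = w" if "q \<in> ball p r" for q w
  proof -
    obtain w1 w2 where w: "w = (w1, w2)" by (cases w)
    obtain z1 z2 x1 x2 where zx: "Z q = (z1, z2)" "X q = (x1, x2)"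
      by (cases "Z q", cases "X q")
    \<comment> \<open>With division replaced by the factor \<open>i\<close>, the inverse identities
      are polynomial consequences of \<open>i\<close> times the determinant being 1.\<close>
    define i where "i = inverse (D q)"
    have i: "i * (z1 * x2 - z2 * x1) = 1"
      using D0[OF that] by (simp add: i_def D_def symplectic_def zx)
    have e: "x / D q = x * i" for x
      by (simp add: i_def divide_inverse)
    show "blinfun_apply (h q) (blinfun_apply (f' q) w) = w"
      "blinfun_apply (f' q) (blinfun_apply (h q) w) = w"
      by (simp_all only: h_def f'_def lin_map_apply A_def B_def C_def E_def w zx fst_conv snd_conv
          prod.inject e) (insert i, (intro conjI; algebra)+)
  qed
  have cont: "continuous_on (ball p r) f'"
    unfolding f'_def by (intro continuous_on_lin_map smooth[THEN Cinf_on_continuous])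
  have p: "p \<in> ball p r" using r(1) by simp
  have inv: "h p o\<^sub>L f' p = id_blinfun"
    by (rule blinfun_eqI) (simp only: blinfun_apply_blinfun_compose inv1[OF p] blinfun_apply_id_blinfun)
  obtain U' V' g g' where IFT: "open U'" "U' \<subseteq> ball p r" "p \<in> U'" "open V'" "\<phi> p \<in> V'"
    "homeomorphism U' V' \<phi> g" "\<And>y. y \<in> V' \<Longrightarrow> (g has_derivative (g' y)) (at y)"
    "\<And>y. y \<in> V' \<Longrightarrow> g' y = inv (blinfun_apply (f' (g y)))"
    "\<And>y. y \<in> V' \<Longrightarrow> bij (blinfun_apply (f' (g y)))"
    by (rule inverse_function_theorem[OF open_ball f' cont p inv], assumption) (rule that; simp)
  \<comment> \<open>Shrinking to a ball makes the chart domain convex, as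
    \<open>frame_constant\<close> requires.\<close>
  obtain s where s: "s > 0" "ball p s \<subseteq> U'"
    using IFT(1,3) unfolding open_contains_ball by blast
  define W where "W = \<phi> ` ball p s"
  have W: "open W"
  proof -
    have "W = V' \<inter> g -` ball p s"
      using IFT(6) s(2) unfolding homeomorphism_def W_def by force
    then show ?thesis
      using continuous_open_preimage[of V' g "ball p s"] IFT(4,6) by (auto simp: homeomorphism_def)
  qed
  have gW: "g y \<in> ball p s" "y \<in> V'" if "y \<in> W" for y
    using that s(2) homeomorphism_apply1[OF IFT(6)] homeomorphism_image1[OF IFT(6)]
    unfolding W_def by (auto simp del: mem_ball)
  have inj: "inj_on \<phi> (ball p s)"
    by (rule inj_on_inverseI[of _ g]) (use s(2) homeomorphism_apply1[OF IFT(6)] in blast)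
  \<comment> \<open>\<open>coordinates\<close> speaks of \<open>inv_into\<close>, so the smoothness
    of \<open>g\<close> has to be transferred to it.\<close>
  have ginv: "g y = inv_into (ball p s) \<phi> y" if "y \<in> W" for y
    using that s(2) homeomorphism_apply1[OF IFT(6)] inv_into_f_f[OF inj] unfolding W_def
    by (auto simp del: mem_ball)
  \<comment> \<open>The derivative of \<open>g\<close> is the inverse of \<open>f'\<close> at
    \<open>g y\<close>, namely \<open>h (g y)\<close>. This is the first-order system needed for the
    bootstrapping.\<close>
  have dg: "has_partials (\<lambda>y. fst (g y)) (fst (Z (g y))) (fst (X (g y))) y \<and>
      has_partials (\<lambda>y. snd (g y)) (snd (Z (g y))) (snd (X (g y))) y" if "y \<in> W" for y
  proof -
    have "g y \<in> ball p r"
      using gW[OF that] s(2) IFT(2) by blast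
    then have "inv (blinfun_apply (f' (g y))) = blinfun_apply (h (g y))"
      by (intro inv_unique_comp) (simp_all add: fun_eq_iff inv1 inv2 del: split_paired_All)
    then show ?thesis
      using IFT(7,8)[OF gW(2)[OF that]] unfolding h_def has_partials_Pair[symmetric] by simp
  qed
  have sr: "ball p s \<subseteq> ball p r" "ball p s \<subseteq> U"
    using s(2) IFT(2) sub by blast+
  have "Ck_on n W (\<lambda>y. fst (g y)) \<and> Ck_on n W (\<lambda>y. snd (g y))" for n
    by (rule Ck_on_inverse_function[OF W, where V = "ball p s" and
          ?P1.0 = "\<lambda>q. fst (Z q)" and ?P2.0 = "\<lambda>q. snd (Z q)" and
          ?Q1.0 = "\<lambda>q. fst (X q)" and ?Q2.0 = "\<lambda>q. snd (X q)"])
      (use gW dg comp[THEN Cinf_on_subset[OF _ sr(2)]] in \<open>simp_all add: Cinf_on_def del: split_paired_All mem_ball\<close>)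
  then have "Cinf_on W (\<lambda>y. fst (g y))" "Cinf_on W (\<lambda>y. snd (g y))"
    by (simp_all add: Cinf_on_def)
  from this[THEN Cinf_on_cong[OF W]] have "Cinf_map_on W (inv_into (ball p s) \<phi>)"
    unfolding Cinf_map_on_def by (simp add: ginv)
  moreover have "Cinf_map_on (ball p s) \<phi>"
    unfolding Cinf_map_on_def \<phi>_def fst_conv snd_conv
    using Cinf_onI[OF open_ball u] Cinf_onI[OF open_ball v] smooth[THEN Cinf_on_subset[OF _ sr(1)]] sr(1)
    by blast
  ultimately have "coordinates (ball p s) W \<phi>"
    using W inj unfolding coordinates_def by (simp add: bij_betw_def W_def)
  moreover have "coordinate_frame (ball p s) \<phi> Z X"
    unfolding coordinate_frame_def using u v D0 sr(1)
    by (auto simp: \<phi>_def defs D_def simp del: mem_ball)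
  ultimately show thesis
    using that[of "ball p s" W \<phi>] s(1) sr(2) by simp
qed

section \<open>Coefficients with respect to a commuting frame\<close>

lemma antiderivative_poly:
  fixes p :: "'a::field_char_0 poly"
  shows "\<exists>P. pderiv P = p"
proof
  let ?P = "\<Sum>i\<le>degree p. monom (coeff p i / of_nat (Suc i)) (Suc i)"
  have "pderiv ?P = (\<Sum>i\<le>degree p. monom (coeff p i) i)"
    by (simp add: pderiv_monom higher_pderiv_sum[of 1, simplified] del: of_nat_Suc)
  then show "pderiv ?P = p" by (simp add: poly_as_sum_of_monoms)
qed

text \<open>In characteristic 0 differentiation lowers a positive degree by exactly one, so an
  element of greatest degree \<open>N\<close> produces elements of every degree up to
  \<open>N\<close>. Subtracting multiples of these to cancel leading terms reaches every polynomial
  of degree at most \<open>N\<close>.\<close>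

lemma pderiv_closed_polys:
  fixes A :: "'a::field_char_0 poly set"
  assumes add: "\<And>p q. p \<in> A \<Longrightarrow> q \<in> A \<Longrightarrow> p + q \<in> A"
    and smult: "\<And>c p. p \<in> A \<Longrightarrow> smult c p \<in> A"
    and pderiv: "\<And>p. p \<in> A \<Longrightarrow> pderiv p \<in> A"
    and nz: "p0 \<in> A" "p0 \<noteq> 0" and bound: "\<And>p. p \<in> A \<Longrightarrow> degree p \<le> n"
  shows "\<exists>N. A = {p. degree p \<le> N}"
proof -
  define P where "P k \<longleftrightarrow> (\<exists>p\<in>A. p \<noteq> 0 \<and> degree p = k)" for k
  have "P (degree p0)" "\<And>k. P k \<Longrightarrow> k \<le> n"
    using nz bound by (auto simp: P_def)
  then obtain N where N: "P N" "\<And>k. P k \<Longrightarrow> k \<le> N"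
    using Nat.ex_has_greatest_nat[of P "degree p0" n] by blast
  have each: "P (N - k)" if "k \<le> N" for k
    using that
  proof (induction k)
    case (Suc k)
    then obtain p where p: "p \<in> A" "p \<noteq> 0" "degree p = N - k"
      by (auto simp: P_def)
    then have "degree (pderiv p) = N - Suc k" "pderiv p \<noteq> 0"
      using Suc.prems by (auto simp: degree_pderiv pderiv_eq_0_iff)
    then show ?case using pderiv[OF p(1)] unfolding P_def by blast
  qed (use N in simp)
  have zero: "0 \<in> A" using smult[OF nz(1), of 0] by simp
  have "q \<in> A" if "degree q \<le> m" "m \<le> N" for q m
    using that
  proof (induction m arbitrary: q)
    case 0
    obtain p where p: "p \<in> A" "p \<noteq> 0" "degree p = 0"
      using each[of N] by (auto simp: P_def)
    then obtain c d where "p = [:c:]" "q = [:d:]" "c \<noteq> 0"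
      using 0 by (metis degree_eq_zeroE le_zero_eq pCons_eq_0_iff)
    then have "q = smult (d / c) p" by simp
    then show ?case using smult p by simp
  next
    case (Suc m)
    obtain p where p: "p \<in> A" "p \<noteq> 0" "degree p = Suc m"
      using each[of "N - Suc m"] Suc.prems by (auto simp: P_def)
    define r where "r = q - smult (coeff q (Suc m) / lead_coeff p) p"
    have "degree r \<le> Suc m"
      unfolding r_def using Suc.prems p by (intro degree_diff_le) auto
    moreover have "coeff r (Suc m) = 0"
      using p unfolding r_def by (simp add: leading_coeff_0_iff[symmetric])
    ultimately have "degree r \<le> m"
      by (metis degree_0 eq_zero_or_degree_less le0 less_Suc_eq_le)
    then have "r \<in> A" using Suc by simp
    moreover have "q = r + smult (coeff q (Suc m) / lead_coeff p) p"
      by (simp add: r_def)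
    ultimately show ?case using add smult p(1) by metis
  qed
  then have "{p. degree p \<le> N} \<subseteq> A" by blast
  moreover have "degree p \<le> N" if "p \<in> A" for p
    using N(2)[of "degree p"] that by (cases "p = 0") (auto simp: P_def)
  ultimately show ?thesis by blast
qed

section \<open>Components of a vector field in the frame (Z, X)\<close>

definition frame_coeff :: "('k::real_normed_field \<times> 'k \<Rightarrow> 'k \<times> 'k) \<Rightarrow> 'k vfield \<Rightarrow> 'k \<times> 'k \<Rightarrow> 'k \<times> 'k" where
  "frame_coeff \<phi> Y q = (vf_apply Y (\<lambda>p. fst (\<phi> p)) q, vf_apply Y (\<lambda>p. snd (\<phi> p)) q)"

text \<open>Applying \<open>Y\<close> to the coordinate functions evaluates the dual coframe on
  \<open>Y\<close>; the result is Cramer's rule for \<open>a\<close>, \<open>b\<close> in Y = a Z +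
  b X.\<close>

lemma frame_coeff_eq:
  assumes "coordinate_frame V \<phi> Z X" "q \<in> V"
  shows "frame_coeff \<phi> Y q = (symplectic (Y q) (X q) / symplectic (Z q) (X q),
    symplectic (Z q) (Y q) / symplectic (Z q) (X q))"
proof -
  have p: "has_partials (\<lambda>q. fst (\<phi> q)) (snd (X q) / symplectic (Z q) (X q))
      (- fst (X q) / symplectic (Z q) (X q)) q"
    "has_partials (\<lambda>q. snd (\<phi> q)) (- snd (Z q) / symplectic (Z q) (X q))
      (fst (Z q) / symplectic (Z q) (X q)) q"
    using assms unfolding coordinate_frame_def by blast+
  show ?thesis
    unfolding frame_coeff_def vf_apply_def has_partials_imp[OF p(1)] has_partials_imp[OF p(2)]
    by (simp add: symplectic_def diff_divide_distrib add_divide_distrib mult.commute)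
qed

lemma frame_coeff_frame:
  assumes "coordinate_frame V \<phi> Z X" "q \<in> V"
  shows "frame_coeff \<phi> Z q = (1, 0)" "frame_coeff \<phi> X q = (0, 1)"
proof -
  have "symplectic (Z q) (X q) \<noteq> 0"
    using assms unfolding coordinate_frame_def by blast
  then show "frame_coeff \<phi> Z q = (1, 0)" "frame_coeff \<phi> X q = (0, 1)"
    unfolding frame_coeff_eq[OF assms] by (simp_all add: symplectic_def mult.commute)
qed

lemma frame_expansion:
  fixes x y z :: "'k::field \<times> 'k"
  assumes "symplectic z x \<noteq> 0"
  shows "fst y = symplectic y x / symplectic z x * fst z + symplectic z y / symplectic z x * fst x"
    "snd y = symplectic y x / symplectic z x * snd z + symplectic z y / symplectic z x * snd x"
  using assms by (simp_all add: field_simps) (simp_all add: symplectic_def algebra_simps)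

lemma frame_coeff_expansion:
  assumes "coordinate_frame V \<phi> Z X" "q \<in> V"
  shows "fst (Y q) = fst (frame_coeff \<phi> Y q) * fst (Z q) + snd (frame_coeff \<phi> Y q) * fst (X q)"
    "snd (Y q) = fst (frame_coeff \<phi> Y q) * snd (Z q) + snd (frame_coeff \<phi> Y q) * snd (X q)"
proof -
  have "symplectic (Z q) (X q) \<noteq> 0"
    using assms unfolding coordinate_frame_def by blast
  from frame_expansion[OF this, of "Y q"]
  show "fst (Y q) = fst (frame_coeff \<phi> Y q) * fst (Z q) + snd (frame_coeff \<phi> Y q) * fst (X q)"
    "snd (Y q) = fst (frame_coeff \<phi> Y q) * snd (Z q) + snd (frame_coeff \<phi> Y q) * snd (X q)"
    unfolding frame_coeff_eq[OF assms] by simp_all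
qed

text \<open>If \<open>W\<close> commutes with \<open>Z\<close> and \<open>X\<close>, then
  [W, a Z + b X] = W(a) Z + W(b) X, so bracketing with \<open>W\<close> differentiates the
  components.\<close>

lemma frame_coeff_bracket:
  assumes V: "open V" "q \<in> V" and fr: "coordinate_frame V \<phi> Z X"
    and smooth: "Cinf_map_on V Z" "Cinf_map_on V X" "Cinf_map_on V (frame_coeff \<phi> Y)"
    and comm: "lie_bracket W Z q = 0" "lie_bracket W X q = 0"
  shows "frame_coeff \<phi> (lie_bracket W Y) q =
    (vf_apply W (\<lambda>p. fst (frame_coeff \<phi> Y p)) q, vf_apply W (\<lambda>p. snd (frame_coeff \<phi> Y p)) q)"
proof -
  define a where "a p = fst (frame_coeff \<phi> Y p)" for p
  define b where "b p = snd (frame_coeff \<phi> Y p)" for p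
  have "Cinf_on V a" "Cinf_on V b"
    using smooth(3) by (simp_all add: Cinf_map_on_def a_def[abs_def] b_def[abs_def])
  note comp = this[THEN Cinf_on_partials[OF _ V(2)]]
  have nz: "symplectic (Z q) (X q) \<noteq> 0"
    using fr V unfolding coordinate_frame_def by blast
  have ex: "fst (Y p) = a p * fst (Z p) + b p * fst (X p)"
    "snd (Y p) = a p * snd (Z p) + b p * snd (X p)" if "p \<in> V" for p
    unfolding a_def b_def by (rule frame_coeff_expansion[OF fr that])+
  \<comment> \<open>One component of the bracket at a time: \<open>f\<close> stands for
    \<open>fst\<close> or \<open>snd\<close>.\<close>
  have br: "vf_apply W (\<lambda>p. f (Y p)) q - vf_apply Y (\<lambda>p. f (W p)) q =
      vf_apply W a q * f (Z q) + vf_apply W b q * f (X q)"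
    if f: "Cinf_on V (\<lambda>p. f (Z p))" "Cinf_on V (\<lambda>p. f (X p))"
      and exf: "\<And>p. p \<in> V \<Longrightarrow> f (Y p) = a p * f (Z p) + b p * f (X p)"
      and c: "vf_apply W (\<lambda>p. f (Z p)) q = vf_apply Z (\<lambda>p. f (W p)) q"
        "vf_apply W (\<lambda>p. f (X p)) q = vf_apply X (\<lambda>p. f (W p)) q" for f :: "'a \<times> 'a \<Rightarrow> 'a"
  proof -
    note fp = f[THEN Cinf_on_partials[OF _ \<open>q \<in> V\<close>]]
    note hp = has_partials_add[OF has_partials_mult[OF comp(1) fp(1)] has_partials_mult[OF comp(2) fp(2)]]
    have Y: "has_partials (\<lambda>p. f (Y p))
      (dx a q * f (Z q) + a q * dx (\<lambda>p. f (Z p)) q + (dx b q * f (X q) + b q * dx (\<lambda>p. f (X p)) q))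
      (dy a q * f (Z q) + a q * dy (\<lambda>p. f (Z p)) q + (dy b q * f (X q) + b q * dy (\<lambda>p. f (X p)) q)) q"
      by (rule has_partials_cong[OF hp V]) (simp add: exf)
    have "vf_apply W (\<lambda>p. f (Y p)) q = vf_apply W a q * f (Z q) + a q * vf_apply W (\<lambda>p. f (Z p)) q
        + vf_apply W b q * f (X q) + b q * vf_apply W (\<lambda>p. f (X p)) q"
      unfolding vf_apply_def has_partials_imp[OF Y] by (simp add: algebra_simps)
    moreover have "vf_apply Y (\<lambda>p. f (W p)) q =
        a q * vf_apply Z (\<lambda>p. f (W p)) q + b q * vf_apply X (\<lambda>p. f (W p)) q"
      unfolding vf_apply_def ex[OF \<open>q \<in> V\<close>] by (simp add: algebra_simps)
    ultimately show ?thesis using c by simp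
  qed
  have Z: "Cinf_on V (\<lambda>p. fst (Z p))" "Cinf_on V (\<lambda>p. snd (Z p))"
    and X: "Cinf_on V (\<lambda>p. fst (X p))" "Cinf_on V (\<lambda>p. snd (X p))"
    using smooth(1,2) by (simp_all add: Cinf_map_on_def)
  note comm' = comm[unfolded lie_bracket_eq_0_iff]
  have L: "lie_bracket W Y q = (vf_apply W a q * fst (Z q) + vf_apply W b q * fst (X q),
      vf_apply W a q * snd (Z q) + vf_apply W b q * snd (X q))"
    unfolding lie_bracket_def
    using br[OF Z(1) X(1) ex(1) conjunct1[OF comm'(1)] conjunct1[OF comm'(2)]]
      br[OF Z(2) X(2) ex(2) conjunct2[OF comm'(1)] conjunct2[OF comm'(2)]] by simp
  have "symplectic (lie_bracket W Y q) (X q) = vf_apply W a q * symplectic (Z q) (X q)"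
    "symplectic (Z q) (lie_bracket W Y q) = vf_apply W b q * symplectic (Z q) (X q)"
    by (simp_all add: L symplectic_def algebra_simps)
  then show ?thesis
    using nz unfolding frame_coeff_eq[OF fr V(2)] a_def[symmetric] b_def[symmetric] by simp
qed

text \<open>By Cramer's rule the determinant times each partial of \<open>f\<close> is a combination
  of Z(f) and X(f), so the differential of \<open>f\<close> vanishes on a convex set.\<close>

lemma frame_constant:
  assumes "convex V" "open V" and fr: "coordinate_frame V \<phi> Z X" and f: "Cinf_on V f"
    and 0: "\<And>q. q \<in> V \<Longrightarrow> vf_apply Z f q = 0" "\<And>q. q \<in> V \<Longrightarrow> vf_apply X f q = 0"
  shows "\<exists>c. \<forall>q\<in>V. f q = c"
proof (rule has_derivative_zero_constant[OF \<open>convex V\<close>])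
  fix q assume q: "q \<in> V"
  define D where "D = symplectic (Z q) (X q)"
  have nz: "D \<noteq> 0"
    using fr q unfolding coordinate_frame_def D_def by blast
  have "D * dx f q = 0" "D * dy f q = 0"
    using 0[OF q] unfolding vf_apply_def symplectic_def D_def by algebra+
  then have "dx f q = 0" "dy f q = 0" using nz by simp_all
  then have "(f has_derivative (\<lambda>h. 0)) (at q)"
    using Cinf_on_partials[OF f q] by (simp add: has_partials_def)
  then show "(f has_derivative (\<lambda>h. 0)) (at q within V)"
    by (rule has_derivative_at_withinI)
qed

text \<open>The second coordinate v has Z(v) = 0 and X(v) = 1, and the chain rule does the
  rest.\<close>

lemma vf_apply_poly:
  assumes "coordinate_frame V \<phi> Z X" "q \<in> V"
  shows "vf_apply Z (\<lambda>q. poly p (snd (\<phi> q))) q = 0"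
    "vf_apply X (\<lambda>q. poly p (snd (\<phi> q))) q = poly (pderiv p) (snd (\<phi> q))"
proof -
  have v: "has_partials (\<lambda>q. snd (\<phi> q)) (- snd (Z q) / symplectic (Z q) (X q))
      (fst (Z q) / symplectic (Z q) (X q)) q"
    using assms unfolding coordinate_frame_def by blast
  have "has_partials (\<lambda>q. snd (\<phi> q)) (dx (\<lambda>q. snd (\<phi> q)) q) (dy (\<lambda>q. snd (\<phi> q)) q) q"
    using v unfolding has_partials_imp[OF v] .
  from has_partials_imp[OF has_partials_poly[OF this]]
  have "vf_apply Y (\<lambda>q. poly p (snd (\<phi> q))) q =
      poly (pderiv p) (snd (\<phi> q)) * snd (frame_coeff \<phi> Y q)" for Y
    by (simp add: vf_apply_def frame_coeff_def algebra_simps)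
  then show "vf_apply Z (\<lambda>q. poly p (snd (\<phi> q))) q = 0"
    "vf_apply X (\<lambda>q. poly p (snd (\<phi> q))) q = poly (pderiv p) (snd (\<phi> q))"
    using frame_coeff_frame[OF assms] by simp_all
qed

section \<open>Nilpotent Lie algebras of vector fields\<close>

text \<open>The coefficients are numbers and are never differentiated. The commutation relations
  allow Y(Y') to be rewritten as a Y'(Z) + b Y'(X), and expanding \<open>Y'\<close> as well gives an
  expression symmetric in the two fields because [Z, X] = 0 at \<open>q\<close>.\<close>

lemma bracket_vanishes_of_commuting:
  assumes ex: "Y q = (a * fst (Z q) + b * fst (X q), a * snd (Z q) + b * snd (X q))"
    "Y' q = (a' * fst (Z q) + b' * fst (X q), a' * snd (Z q) + b' * snd (X q))"
    and comm: "lie_bracket Z X q = 0" "lie_bracket Z Y q = 0" "lie_bracket Z Y' q = 0"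
      "lie_bracket X Y q = 0" "lie_bracket X Y' q = 0"
  shows "lie_bracket Y Y' q = 0"
proof -
  have lin: "vf_apply Y f q = a * vf_apply Z f q + b * vf_apply X f q"
    "vf_apply Y' f q = a' * vf_apply Z f q + b' * vf_apply X f q" for f
    by (simp_all add: vf_apply_def ex algebra_simps)
  note comm' = comm[unfolded lie_bracket_eq_0_iff lin]
  show ?thesis
    unfolding lie_bracket_eq_0_iff lin
    using comm' by (simp add: algebra_simps)
qed

lemma lie_bracket_swap: "lie_bracket Y X = - lie_bracket X Y"
  by (simp add: lie_bracket_def fun_eq_iff)

lemma lie_bracket_self: "lie_bracket X X = 0"
  by (simp add: lie_bracket_def fun_eq_iff zero_prod_def)

lemma lower_central_subset:
  assumes "vf_lie_algebra U g"
  shows "lower_central g n \<subseteq> g"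
proof (induction n)
  case (Suc n)
  have "{lie_bracket X Y | X Y. X \<in> g \<and> Y \<in> lower_central g n} \<subseteq> g"
    using assms Suc unfolding vf_lie_algebra_def by blast
  then show ?case
    using assms unfolding vf_lie_algebra_def by (simp add: vf.span_minimal)
qed simp

lemma lie_bracket_in_lower_central:
  "X \<in> g \<Longrightarrow> Y \<in> lower_central g n \<Longrightarrow> lie_bracket X Y \<in> lower_central g (Suc n)"
  by (auto intro!: vf.span_base)

lemma vf_span_vanishes:
  assumes "X \<in> vf_span S" "\<And>Y. Y \<in> S \<Longrightarrow> Y q = 0"
  shows "X q = 0"
  using assms(1)
  by (induction rule: vf.span_induct_alt) (auto simp: assms(2) vf_scale_def zero_prod_def)

lemma vf_subspace_combination:
  assumes "vf_subspace g" "Y \<in> g" "Y' \<in> g"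
  shows "(\<lambda>p. (c * fst (Y p) + c' * fst (Y' p), c * snd (Y p) + c' * snd (Y' p))) \<in> g"
proof -
  have "vf_scale c Y + vf_scale c' Y' \<in> g"
    using assms by (intro vf.subspace_add vf.subspace_scale)
  then show ?thesis by (simp add: vf_scale_def plus_fun_def plus_prod_def)
qed

text \<open>Numbering starts with \<open>g\<close> itself as term 0, so non-commutativity puts the
  first zero term at index \<open>k\<close> at least 2. \<open>Z\<close> is taken from term
  \<open>k - 1\<close>: that term is spanned by brackets, and its brackets with \<open>g\<close> lie
  in the zero term.\<close>

lemma central_noncommuting_pair:
  assumes g: "vf_lie_algebra U g" and n: "lower_central g n = {0}" and na: "\<not> abelian g"
  obtains Z where "Z \<in> g" "Z \<noteq> 0" "\<And>Y. Y \<in> g \<Longrightarrow> lie_bracket Y Z = 0"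
    "\<And>q. (\<And>Y Y'. Y \<in> g \<Longrightarrow> Y' \<in> g \<Longrightarrow> lie_bracket Y Y' q = 0) \<Longrightarrow> Z q = 0"
proof -
  define k where "k = (LEAST k. lower_central g k = {0})"
  have k: "lower_central g k = {0}" "\<And>j. j < k \<Longrightarrow> lower_central g j \<noteq> {0}"
    unfolding k_def using n by (rule LeastI, metis not_less_Least)
  obtain Y Y' where Y: "Y \<in> g" "Y' \<in> g" "lie_bracket Y Y' \<noteq> 0"
    using na unfolding abelian_def by blast
  have "lie_bracket Y Y' \<in> g"
    using g Y unfolding vf_lie_algebra_def by blast
  then have "k \<noteq> 0"
    using k(1) Y(3) by (metis lower_central.simps(1) singletonD)
  moreover have "k \<noteq> Suc 0"
    using lie_bracket_in_lower_central[of Y g Y' 0] Y k(1) by (metis lower_central.simps(1) singletonD)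
  ultimately obtain m where m: "k = Suc (Suc m)"
    by (metis not0_implies_Suc)
  have "0 \<in> lower_central g (Suc m)"
    by (simp add: vf.span_zero)
  then obtain Z where Z: "Z \<in> lower_central g (Suc m)" "Z \<noteq> 0"
    using k(2)[of "Suc m"] m by blast
  have "Z q = 0" if "\<And>Y Y'. Y \<in> g \<Longrightarrow> Y' \<in> g \<Longrightarrow> lie_bracket Y Y' q = 0" for q
  proof (rule vf_span_vanishes[of Z _ q])
    show "Z \<in> vf_span {lie_bracket X Y | X Y. X \<in> g \<and> Y \<in> lower_central g m}"
      using Z(1) by simp
  qed (use that lower_central_subset[OF g, of m] in blast)
  moreover have "lie_bracket Y Z = 0" if "Y \<in> g" for Y
    using lie_bracket_in_lower_central[OF that Z(1)] k(1) m by (metis singletonD)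
  moreover have "Z \<in> g" using lower_central_subset[OF g] Z(1) by blast
  ultimately show thesis using that Z(2) by blast
qed

lemma symplectic_eq_0:
  fixes z y :: "'k::field \<times> 'k"
  assumes "symplectic z y = 0" "z \<noteq> 0"
  obtains a where "y = (a * fst z, a * snd z)"
proof -
  obtain z1 z2 y1 y2 where [simp]: "z = (z1, z2)" "y = (y1, y2)"
    by (cases z, cases y)
  have *: "z1 * y2 = z2 * y1" "z1 \<noteq> 0 \<or> z2 \<noteq> 0"
    using assms by (auto simp: symplectic_def zero_prod_def)
  show thesis
  proof (cases "z1 = 0")
    case True
    then show ?thesis using * that[of "y2 / z2"] by simp
  next
    case False
    then show ?thesis using * that[of "y1 / z1"] by (simp add: field_simps)
  qed
qed

section \<open>The model algebra in terms of polynomials\<close>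

lemma vf_span_dy:
  "vf_span {vf_on W (\<lambda>p. 0) (\<lambda>p. 1)} = range (\<lambda>c. vf_on W (\<lambda>p. 0) (\<lambda>p. c))"
proof -
  have "vf_scale c (vf_on W (\<lambda>p. 0) (\<lambda>p. 1)) = vf_on W (\<lambda>p. 0) (\<lambda>p. c)" for c :: 'a
    by (auto simp: vf_scale_def vf_on_def fun_eq_iff zero_prod_def)
  then show ?thesis by (simp add: vf.span_singleton)
qed

text \<open>Polynomials of bounded degree form a subspace containing the monomials; conversely,
  splitting off the top monomial lowers the degree. Indexing by polynomials matches the form in
  which the components of \<open>g\<close> will be found.\<close>

lemma vf_span_dx:
  "vf_span {vf_on W (\<lambda>(x, y). y ^ i) (\<lambda>p. 0) | i::nat. i \<le> N} =
    {vf_on W (\<lambda>(x, y). poly p y) (\<lambda>q. 0) | p :: 'k::real_normed_field poly. degree p \<le> N}"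
    (is "vf_span ?B = ?P")
proof
  have "vf_subspace ?P"
  proof (rule vf.subspaceI)
    show "0 \<in> ?P"
      by (rule CollectI, rule exI[of _ 0]) (auto simp: vf_on_def fun_eq_iff zero_prod_def)
  next
    fix X Y assume "X \<in> ?P" "Y \<in> ?P"
    then obtain p q where "X = vf_on W (\<lambda>(x, y). poly p y) (\<lambda>q. 0)" "degree p \<le> N"
      "Y = vf_on W (\<lambda>(x, y). poly q y) (\<lambda>q. 0)" "degree q \<le> N"
      by blast
    then show "X + Y \<in> ?P"
      by (intro CollectI exI[of _ "p + q"]) (auto simp: vf_on_def fun_eq_iff zero_prod_def degree_add_le)
  next
    fix c X assume "X \<in> ?P"
    then obtain p where "X = vf_on W (\<lambda>(x, y). poly p y) (\<lambda>q. 0)" "degree p \<le> N"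
      by blast
    then show "vf_scale c X \<in> ?P"
      by (intro CollectI exI[of _ "smult c p"])
        (auto simp: vf_on_def vf_scale_def fun_eq_iff zero_prod_def intro: order_trans[OF degree_smult_le])
  qed
  moreover have "?B \<subseteq> ?P"
  proof
    fix X assume "X \<in> ?B"
    then obtain i where "X = vf_on W (\<lambda>(x, y). y ^ i) (\<lambda>p. 0)" "i \<le> N" by blast
    then show "X \<in> ?P"
      by (intro CollectI exI[of _ "monom 1 i"]) (auto simp: poly_monom degree_monom_eq)
  qed
  ultimately show "vf_span ?B \<subseteq> ?P" by (rule vf.span_minimal[rotated])
next
  have "vf_on W (\<lambda>(x, y). poly p y) (\<lambda>q. 0) \<in> vf_span ?B" if "degree p \<le> m" "m \<le> N" for p :: "'k poly" and m
    using that
  proof (induction m arbitrary: p)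
    case 0
    then obtain c where c: "p = [:c:]" by (metis degree_eq_zeroE le_zero_eq)
    have "vf_on W (\<lambda>(x, y). poly p y) (\<lambda>q. 0) =
        vf_scale c (vf_on W (\<lambda>(x, y). y ^ 0) (\<lambda>p. 0))"
      by (auto simp: c vf_on_def vf_scale_def fun_eq_iff zero_prod_def)
    moreover have "vf_on W (\<lambda>(x, y). y ^ 0) (\<lambda>p. 0) \<in> vf_span ?B"
      by (intro vf.span_base) blast
    ultimately show ?case by (simp only: vf.span_scale)
  next
    case (Suc m)
    define r where "r = p - monom (coeff p (Suc m)) (Suc m)"
    have "degree r \<le> m"
    proof (rule degree_le, intro allI impI)
      fix i assume "m < i"
      then show "coeff r i = 0"
        using Suc.prems by (cases "i = Suc m") (auto simp: r_def coeff_eq_0)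
    qed
    then have r: "vf_on W (\<lambda>(x, y). poly r y) (\<lambda>q. 0) \<in> vf_span ?B"
      using Suc by simp
    have "vf_on W (\<lambda>(x, y). y ^ Suc m) (\<lambda>p. 0) \<in> vf_span ?B"
      using Suc.prems by (intro vf.span_base) blast
    moreover have "vf_on W (\<lambda>(x, y). poly p y) (\<lambda>q. 0) = vf_on W (\<lambda>(x, y). poly r y) (\<lambda>q. 0) +
        vf_scale (coeff p (Suc m)) (vf_on W (\<lambda>(x, y). y ^ Suc m) (\<lambda>p. 0))"
      by (auto simp: r_def poly_monom vf_on_def vf_scale_def fun_eq_iff zero_prod_def)
    ultimately show ?case using r by (simp only: vf.span_add vf.span_scale)
  qed
  then show "?P \<subseteq> vf_span ?B" by blast
qed

lemma vf_span_model:
  "vf_span {vf_on W (\<lambda>p. 0) (\<lambda>p. 1)} + vf_span {vf_on W (\<lambda>(x, y). y ^ i) (\<lambda>p. 0) | i::nat. i \<le> N} =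
    {vf_on W (\<lambda>q. poly p (snd q)) (\<lambda>q. c) | c (p :: 'k::real_normed_field poly). degree p \<le> N}"
proof -
  have *: "vf_on W (\<lambda>p. 0) (\<lambda>p. c) + vf_on W (\<lambda>(x, y). poly p y) (\<lambda>q. 0) =
      vf_on W (\<lambda>q. poly p (snd q)) (\<lambda>q. c)" for c and p :: "'k poly"
    by (auto simp: vf_on_def fun_eq_iff zero_prod_def)
  show ?thesis
    unfolding vf_span_dy vf_span_dx set_plus_def using * by (fastforce simp: *[symmetric])
qed

section \<open>Normal form of a nilpotent non-abelian algebra\<close>

lemma nilpotent_vector_fields_model:
  fixes g :: "'k::{real_normed_field,euclidean_space} vfield set"
  assumes g: "vf_lie_algebra U g" and nil: "nilpotent g" and na: "\<not> abelian g"
  shows "\<exists>N\<ge>1. \<exists>V W \<phi>. V \<noteq> {} \<and> V \<subseteq> U \<and> coordinates V W \<phi> \<and>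
    in_coordinates V W \<phi> ` g =
      vf_span {vf_on W (\<lambda>p. 0) (\<lambda>p. 1)} +
      vf_span {vf_on W (\<lambda>(x, y). y ^ i) (\<lambda>p. 0) | i::nat. i \<le> N}"
proof -
  obtain n where n: "lower_central g n = {0}"
    using nil unfolding nilpotent_def by blast
  obtain Z where Z: "Z \<in> g" "Z \<noteq> 0" and central: "\<And>Y. Y \<in> g \<Longrightarrow> lie_bracket Y Z = 0"
    and Z_vanishes: "\<And>q. (\<And>Y Y'. Y \<in> g \<Longrightarrow> Y' \<in> g \<Longrightarrow> lie_bracket Y Y' q = 0) \<Longrightarrow> Z q = 0"
    using central_noncommuting_pair[OF g n na] by blast
  have "open U" and sub: "vf_subspace g" and bracket: "\<And>X Y. X \<in> g \<Longrightarrow> Y \<in> g \<Longrightarrow> lie_bracket X Y \<in> g"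
    and smooth: "\<And>X. X \<in> g \<Longrightarrow> Cinf_map_on U X"
    and support: "\<And>X q. X \<in> g \<Longrightarrow> q \<notin> U \<Longrightarrow> X q = 0"
    using g unfolding vf_lie_algebra_def vector_fields_def by blast+
  have central': "lie_bracket Z Y = 0" if "Y \<in> g" for Y
    using central[OF that] lie_bracket_swap[of Z Y] by simp
  define H where "H = {Y. \<forall>q. symplectic (Z q) (Y q) = 0}"
  have "\<not> g \<subseteq> H"
  proof
    assume gH: "g \<subseteq> H"
    obtain q where q: "Z q \<noteq> 0" using \<open>Z \<noteq> 0\<close> by (auto simp: fun_eq_iff)
    have "lie_bracket Y Y' q = 0" if Y: "Y \<in> g" "Y' \<in> g" for Y Y'
    proof -
      have "symplectic (Z q) (Y q) = 0" "symplectic (Z q) (Y' q) = 0"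
        using gH Y unfolding H_def by blast+
      then obtain a a' where "Y q = (a * fst (Z q), a * snd (Z q))" "Y' q = (a' * fst (Z q), a' * snd (Z q))"
        using symplectic_eq_0[OF _ q] by metis
      \<comment> \<open>\<open>Z\<close> fills both frame slots here, with second coefficient 0,
        since all fields are multiples of \<open>Z\<close> at \<open>q\<close>.\<close>
      then show ?thesis
        using bracket_vanishes_of_commuting[of Y q a Z 0 Z Y' a' 0] central'[OF Z(1)]
          central'[OF Y(1)] central'[OF Y(2)] by simp
    qed
    with Z_vanishes q show False by blast
  qed
  \<comment> \<open>Term 0 is not inside \<open>H\<close> and term \<open>n\<close> is, so the
    inclusion starts to hold at some step. Choosing \<open>X\<close> just before it puts every
    [Y, X] into \<open>H\<close>.\<close>
  then obtain k where k: "\<not> lower_central g k \<subseteq> H" "lower_central g (Suc k) \<subseteq> H"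
  proof -
    have "lower_central g n \<subseteq> H"
      using n by (auto simp: H_def symplectic_def)
    then have "\<exists>k. \<not> lower_central g k \<subseteq> H \<and> lower_central g (Suc k) \<subseteq> H"
      using \<open>\<not> g \<subseteq> H\<close> by (induction n) (auto simp del: lower_central.simps(2))
    then show thesis using that by blast
  qed
  then obtain X p where X: "X \<in> lower_central g k" and nz: "symplectic (Z p) (X p) \<noteq> 0"
    unfolding H_def by blast
  have Xg: "X \<in> g" using X lower_central_subset[OF g] by blast
  have "Z p \<noteq> 0" using nz by (auto simp: symplectic_def)
  then have "p \<in> U" using support[OF Z(1)] by blast
  obtain V W \<phi> where V: "p \<in> V" "V \<subseteq> U" "convex V" and coord: "coordinates V W \<phi>"
    and fr: "coordinate_frame V \<phi> Z X"
    using coordinates_of_commuting_frame[OF \<open>open U\<close> \<open>p \<in> U\<close> smooth[OF Z(1)] smooth[OF Xg] _ nz]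
      central'[OF Xg] by (metis zero_fun_apply)
  have "open V" "bij_betw \<phi> V W" and \<phi>: "Cinf_map_on V \<phi>"
    using coord unfolding coordinates_def by blast+
  have smoothV: "Cinf_map_on V Y" if "Y \<in> g" for Y
    using smooth[OF that] Cinf_on_subset[OF _ V(2)] unfolding Cinf_map_on_def by blast
  have smooth_coeff: "Cinf_map_on V (frame_coeff \<phi> Y)" if "Y \<in> g" for Y
    using smoothV[OF that] \<phi> \<open>open V\<close> unfolding Cinf_map_on_def frame_coeff_def vf_apply_def fst_conv snd_conv
    by (intro conjI Cinf_on_add Cinf_on_mult Cinf_on_dx Cinf_on_dy; blast)
  define a where "a Y q = fst (frame_coeff \<phi> Y q)" for Y q
  define b where "b Y q = snd (frame_coeff \<phi> Y q)" for Y q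
  define v where "v q = snd (\<phi> q)" for q
  have sm_a: "Cinf_on V (a Y)" and sm_b: "Cinf_on V (b Y)" if "Y \<in> g" for Y
    using smooth_coeff[OF that] by (simp_all add: Cinf_map_on_def a_def[abs_def] b_def[abs_def])
  have sm_v: "Cinf_on V v"
    using \<phi> by (simp add: Cinf_map_on_def v_def[abs_def])
  have expand: "Y q = (a Y q * fst (Z q) + b Y q * fst (X q), a Y q * snd (Z q) + b Y q * snd (X q))"
    if "q \<in> V" for Y q
    using frame_coeff_expansion[OF fr that, of Y] unfolding a_def b_def by (simp add: prod_eq_iff)
  \<comment> \<open>In this statement \<open>W\<close> is one of the frame fields, not the range of
    the chart.\<close>
  have coeff_bracket: "a (lie_bracket W Y) q = vf_apply W (a Y) q" "b (lie_bracket W Y) q = vf_apply W (b Y) q"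
    if "q \<in> V" "Y \<in> g" "W = Z \<or> W = X" for W Y q
  proof -
    have "lie_bracket W Z q = 0" "lie_bracket W X q = 0"
      using that(3) central[OF Z(1)] central[OF Xg] central'[OF Xg] lie_bracket_self[of X] by auto
    from frame_coeff_bracket[OF \<open>open V\<close> \<open>q \<in> V\<close> fr smoothV[OF Z(1)] smoothV[OF Xg] smooth_coeff[OF that(2)] this]
    show "a (lie_bracket W Y) q = vf_apply W (a Y) q" "b (lie_bracket W Y) q = vf_apply W (b Y) q"
      unfolding a_def b_def by simp_all
  qed
  have frame_0: "frame_coeff \<phi> 0 q = 0" for q
    by (simp add: frame_coeff_def vf_apply_def zero_prod_def)
  have Za: "vf_apply Z (a Y) q = 0" and Zb: "vf_apply Z (b Y) q = 0" if "q \<in> V" "Y \<in> g" for Y q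
    using coeff_bracket[OF that, of Z] central'[OF that(2)] by (simp_all add: a_def b_def frame_0)
  \<comment> \<open>A field in \<open>H\<close> has no \<open>X\<close> component; with
    \<open>coeff_bracket\<close> this gives X(b) = 0.\<close>
  have b_bracket: "b (lie_bracket X Y) q = 0" if "q \<in> V" "Y \<in> g" for Y q
  proof -
    have "lie_bracket Y X \<in> H"
      using lie_bracket_in_lower_central[OF that(2) X] k(2) by blast
    then have "symplectic (Z q) (lie_bracket Y X q) = 0"
      unfolding H_def by blast
    then have "symplectic (Z q) (lie_bracket X Y q) = 0"
      unfolding lie_bracket_swap[of X Y] by (simp add: symplectic_def)
    then show ?thesis by (simp add: b_def frame_coeff_eq[OF fr that(1)])
  qed
  have b_const: "\<exists>c. \<forall>q\<in>V. b Y q = c" if "Y \<in> g" for Y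
    using frame_constant[OF V(3) \<open>open V\<close> fr sm_b[OF that]] Zb b_bracket coeff_bracket(2) that by metis
  \<comment> \<open>Since X(a) is the component of [X, Y], it is a polynomial in \<open>v\<close> by
    induction. Subtracting an antiderivative in \<open>v\<close> from \<open>a\<close> leaves a
    function killed by \<open>Z\<close> and \<open>X\<close>, hence a constant.\<close>
  have a_poly: "\<exists>P. degree P \<le> m \<and> (\<forall>q\<in>V. a Y q = poly P (v q))"
    if "Y \<in> g" "(lie_bracket X ^^ m) Y = 0" for m Y
    using that
  proof (induction m arbitrary: Y)
    case 0
    then have "Y = 0" by (simp only: funpow.simps id_apply)
    then have "a Y q = poly 0 (v q)" for q
      by (simp only: a_def frame_0 poly_0 fst_zero)
    then show ?case by (intro exI[of _ 0]) simp
  next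
    case (Suc m)
    have "(lie_bracket X ^^ m) (lie_bracket X Y) = 0"
      using Suc.prems(2) by (simp only: funpow.simps o_apply funpow_swap1)
    then obtain P where P: "degree P \<le> m" "\<And>q. q \<in> V \<Longrightarrow> a (lie_bracket X Y) q = poly P (v q)"
      using Suc.IH[OF bracket[OF Xg Suc.prems(1)]] by blast
    obtain Q where Q: "pderiv Q = P" using antiderivative_poly by blast
    define f where "f q = a Y q + poly (- Q) (v q)" for q
    have f: "vf_apply W f q = vf_apply W (a Y) q + vf_apply W (\<lambda>q. poly (- Q) (v q)) q" if "q \<in> V" for W q
      using has_partials_imp[OF has_partials_add[OF Cinf_on_partials[OF sm_a[OF Suc.prems(1)] that]
            Cinf_on_partials[OF Cinf_on_poly[OF \<open>open V\<close> sm_v, of "- Q"] that]]]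
      unfolding vf_apply_def f_def[abs_def] by (simp only: distrib_left ac_simps)
    have "vf_apply Z f q = 0" "vf_apply X f q = 0" if "q \<in> V" for q
      unfolding f[OF that] using Za[OF that Suc.prems(1)] vf_apply_poly[OF fr that, of "- Q"] P(2)[OF that]
        coeff_bracket(1)[OF that Suc.prems(1), of X] Q
      by (simp_all add: v_def pderiv_minus)
    moreover have "Cinf_on V f"
      unfolding f_def by (intro Cinf_on_add Cinf_on_poly sm_a sm_v Suc.prems \<open>open V\<close>)
    ultimately obtain c where c: "\<And>q. q \<in> V \<Longrightarrow> f q = c"
      using frame_constant[OF V(3) \<open>open V\<close> fr] by metis
    have "a Y q = poly (Q + [:c:]) (v q)" if "q \<in> V" for q
      using c[OF that] by (simp add: f_def algebra_simps)
    moreover have "degree (Q + [:c:]) \<le> Suc m"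
      using P(1) Q degree_pderiv[of Q] by (intro degree_add_le) auto
    ultimately show ?case by blast
  qed
  have ad: "(lie_bracket X ^^ m) Y \<in> lower_central g m" if "Y \<in> g" for Y m
    using that by (induction m) (auto intro: lie_bracket_in_lower_central[OF Xg] simp del: lower_central.simps(2))
  \<comment> \<open>Building the bound into \<open>A\<close> provides the bounded degree for
    \<open>pderiv_closed_polys\<close>; \<open>a_in_A\<close> shows that every field of
    \<open>g\<close> is still represented.\<close>
  define A where "A = {P. degree P \<le> n \<and> (\<exists>Y\<in>g. \<forall>q\<in>V. a Y q = poly P (v q))}"
  have a_in_A: "\<exists>P\<in>A. \<forall>q\<in>V. a Y q = poly P (v q)" if "Y \<in> g" for Y
  proof -
    have "(lie_bracket X ^^ n) Y = 0" using ad[OF that, of n] n by blast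
    from a_poly[OF that this] that show ?thesis unfolding A_def by blast
  qed
  have comb: "\<exists>Y''\<in>g. \<forall>q. frame_coeff \<phi> Y'' q =
      (c * a Y q + c' * a Y' q, c * b Y q + c' * b Y' q)" if "Y \<in> g" "Y' \<in> g" for Y Y' c c'
    by (rule bexI[OF _ vf_subspace_combination[OF sub that, of c c']])
      (simp add: frame_coeff_def a_def b_def vf_apply_def algebra_simps)
  obtain N where N: "A = {P. degree P \<le> N}"
  proof -
    have "\<exists>N. A = {P. degree P \<le> N}"
    proof (rule pderiv_closed_polys)
      fix P Q assume "P \<in> A" "Q \<in> A"
      then obtain Y Y' where "degree P \<le> n" "degree Q \<le> n" and Y: "Y \<in> g" "Y' \<in> g"
        "\<forall>q\<in>V. a Y q = poly P (v q)" "\<forall>q\<in>V. a Y' q = poly Q (v q)"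
        unfolding A_def by blast
      moreover obtain Y'' where "Y'' \<in> g" "\<forall>q. frame_coeff \<phi> Y'' q =
          (1 * a Y q + 1 * a Y' q, 1 * b Y q + 1 * b Y' q)"
        using comb[OF Y(1,2)] by blast
      ultimately show "P + Q \<in> A"
        unfolding A_def by (auto intro!: degree_add_le bexI[of _ Y''] simp: a_def[of Y''])
    next
      fix c P assume "P \<in> A"
      then obtain Y where "degree P \<le> n" and Y: "Y \<in> g" "\<forall>q\<in>V. a Y q = poly P (v q)"
        unfolding A_def by blast
      moreover obtain Y'' where "Y'' \<in> g" "\<forall>q. frame_coeff \<phi> Y'' q =
          (c * a Y q + 0 * a Y q, c * b Y q + 0 * b Y q)"
        using comb[OF Y(1) Y(1)] by blast
      ultimately show "smult c P \<in> A"
        unfolding A_def by (auto intro!: order_trans[OF degree_smult_le] bexI[of _ Y''] simp: a_def[of Y''])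
    next
      fix P assume "P \<in> A"
      then obtain Y where P: "degree P \<le> n" and Y: "Y \<in> g" "\<And>q. q \<in> V \<Longrightarrow> a Y q = poly P (v q)"
        unfolding A_def by blast
      have "a (lie_bracket X Y) q = poly (pderiv P) (v q)" if "q \<in> V" for q
      proof -
        have "vf_apply X (a Y) q = vf_apply X (\<lambda>q. poly P (v q)) q"
          unfolding vf_apply_def using dx_cong[OF Y(2) \<open>open V\<close> that] dy_cong[OF Y(2) \<open>open V\<close> that] by simp
        then show ?thesis
          using coeff_bracket(1)[OF that Y(1), of X] vf_apply_poly(2)[OF fr that, of P] by (simp add: v_def)
      qed
      moreover have "degree (pderiv P) \<le> n" using P by (simp add: degree_pderiv)
      ultimately show "pderiv P \<in> A"
        using bracket[OF Xg Y(1)] unfolding A_def by blast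
    next
      \<comment> \<open>\<open>Z\<close> itself supplies a nonzero element of
        \<open>A\<close>.\<close>
      have "a Z q = poly 1 (v q)" if "q \<in> V" for q
        using frame_coeff_frame(1)[OF fr that] by (simp add: a_def)
      moreover have "degree (1 :: 'k poly) \<le> n" by simp
      ultimately show "1 \<in> A"
        using Z(1) unfolding A_def by blast
    qed (auto simp: A_def)
    then show thesis using that by blast
  qed
  \<comment> \<open>If only constants occurred, \<open>X\<close> as well as \<open>Z\<close> would
    commute with all of \<open>g\<close> at \<open>p\<close>. Then every bracket, and with it
    \<open>Z\<close>, would vanish at \<open>p\<close>.\<close>
  have "N \<noteq> 0"
  proof
    assume "N = 0"
    have X_central: "lie_bracket X Y p = 0" if "Y \<in> g" for Y
    proof -
      obtain P where P: "P \<in> A" "\<And>q. q \<in> V \<Longrightarrow> a Y q = poly P (v q)"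
        using a_in_A[OF \<open>Y \<in> g\<close>] by blast
      then obtain c where "P = [:c:]"
        using N \<open>N = 0\<close> by (auto elim: degree_eq_zeroE)
      then have *: "a Y q = c" if "q \<in> V" for q using P(2) that by simp
      have "vf_apply X (a Y) p = vf_apply X (\<lambda>q. c) p"
        unfolding vf_apply_def using dx_cong[OF * \<open>open V\<close> V(1)] dy_cong[OF * \<open>open V\<close> V(1)] by simp
      then have "a (lie_bracket X Y) p = 0"
        using coeff_bracket(1)[OF V(1) that, of X] has_partials_imp[OF has_partials_const[of c p]]
        by (simp add: vf_apply_def)
      then show ?thesis
        using expand[OF V(1), of "lie_bracket X Y"] b_bracket[OF V(1) that] by (simp add: zero_prod_def)
    qed
    have "Z p = 0"
    proof (rule Z_vanishes)
      fix Y Y' assume "Y \<in> g" "Y' \<in> g"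
      then show "lie_bracket Y Y' p = 0"
        using bracket_vanishes_of_commuting[of Y p "a Y p" Z "b Y p" X Y' "a Y' p" "b Y' p",
            OF expand[OF V(1)] expand[OF V(1)]] X_central central' Xg by simp
    qed
    with \<open>Z p \<noteq> 0\<close> show False by simp
  qed
  have in_coord: "in_coordinates V W \<phi> Y = vf_on W (\<lambda>q. poly P (snd q)) (\<lambda>q. c)"
    if "\<And>q. q \<in> V \<Longrightarrow> a Y q = poly P (v q)" "\<And>q. q \<in> V \<Longrightarrow> b Y q = c" for Y P c
  proof
    fix q
    have "inv_into V \<phi> q \<in> V" "\<phi> (inv_into V \<phi> q) = q" if "q \<in> W"
      using \<open>bij_betw \<phi> V W\<close> that by (auto simp: bij_betw_def inv_into_into f_inv_into_f)
    then show "in_coordinates V W \<phi> Y q = vf_on W (\<lambda>q. poly P (snd q)) (\<lambda>q. c) q"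
      using that unfolding in_coordinates_def vf_on_def
      by (simp add: a_def b_def v_def frame_coeff_def)
  qed
  have "in_coordinates V W \<phi> ` g = {vf_on W (\<lambda>q. poly P (snd q)) (\<lambda>q. c) | c P. degree P \<le> N}"
  proof (intro equalityI subsetI)
    fix F assume "F \<in> in_coordinates V W \<phi> ` g"
    then obtain Y where Y: "Y \<in> g" "F = in_coordinates V W \<phi> Y" by blast
    obtain P where "P \<in> A" "\<And>q. q \<in> V \<Longrightarrow> a Y q = poly P (v q)"
      using a_in_A[OF Y(1)] by blast
    moreover obtain c where "\<And>q. q \<in> V \<Longrightarrow> b Y q = c"
      using b_const[OF Y(1)] by blast
    ultimately show "F \<in> {vf_on W (\<lambda>q. poly P (snd q)) (\<lambda>q. c) | c P. degree P \<le> N}"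
      using in_coord[of Y P c] Y(2) N by blast
  next
    fix F assume "F \<in> {vf_on W (\<lambda>q. poly P (snd q)) (\<lambda>q. c) | c P. degree P \<le> N}"
    then obtain c P where F: "F = vf_on W (\<lambda>q. poly P (snd q)) (\<lambda>q. c)" "P \<in> A"
      using N by blast
    then obtain Y where Y: "Y \<in> g" "\<And>q. q \<in> V \<Longrightarrow> a Y q = poly P (v q)"
      unfolding A_def by blast
    obtain d where d: "\<And>q. q \<in> V \<Longrightarrow> b Y q = d" using b_const[OF Y(1)] by blast
    \<comment> \<open>\<open>X\<close> has components (0, 1), so adding \<open>c - d\<close> times
      \<open>X\<close> corrects the second component from \<open>d\<close> to \<open>c\<close> and
      leaves the polynomial unchanged.\<close>
    obtain Y' where Y': "Y' \<in> g" "\<And>q. frame_coeff \<phi> Y' q =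
        (1 * a Y q + (c - d) * a X q, 1 * b Y q + (c - d) * b X q)"
      using comb[OF Y(1) Xg, of 1 "c - d"] by blast
    have "a Y' q = poly P (v q)" "b Y' q = c" if "q \<in> V" for q
      using Y'(2)[of q] Y(2)[OF that] d[OF that] frame_coeff_frame(2)[OF fr that]
      by (simp_all add: a_def b_def)
    then have "F = in_coordinates V W \<phi> Y'" using in_coord[of Y' P c] F(1) by simp
    then show "F \<in> in_coordinates V W \<phi> ` g" using Y'(1) by blast
  qed
  then have "in_coordinates V W \<phi> ` g =
      vf_span {vf_on W (\<lambda>p. 0) (\<lambda>p. 1)} +
      vf_span {vf_on W (\<lambda>(x, y). y ^ i) (\<lambda>p. 0) | i::nat. i \<le> N}"
    by (simp only: vf_span_model)
  moreover have "1 \<le> N" using \<open>N \<noteq> 0\<close> by simp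
  ultimately show ?thesis using V(1,2) coord by blast
qed

theorem theorem4p2:
  "(\<forall>U (g :: real vfield set). vf_lie_algebra U g \<and> nilpotent g \<and> \<not> abelian g \<longrightarrow>
      (\<exists>N\<ge>1. \<exists>V W \<phi>. V \<noteq> {} \<and> V \<subseteq> U \<and> coordinates V W \<phi> \<and>
         in_coordinates V W \<phi> ` g =
           vf_span {vf_on W (\<lambda>p. 0) (\<lambda>p. 1)} +
           vf_span {vf_on W (\<lambda>(x, y). y ^ i) (\<lambda>p. 0) | i::nat. i \<le> N})) \<and>
   (\<forall>U (g :: complex vfield set). vf_lie_algebra U g \<and> nilpotent g \<and> \<not> abelian g \<longrightarrow>
      (\<exists>N\<ge>1. \<exists>V W \<phi>. V \<noteq> {} \<and> V \<subseteq> U \<and> coordinates V W \<phi> \<and>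
         in_coordinates V W \<phi> ` g =
           vf_span {vf_on W (\<lambda>p. 0) (\<lambda>p. 1)} +
           vf_span {vf_on W (\<lambda>(x, y). y ^ i) (\<lambda>p. 0) | i::nat. i \<le> N}))"
  by (intro conjI allI impI nilpotent_vector_fields_model) (elim conjE; assumption)+

end
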